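(* Let $0<q<1$ and let $(a,b,c,d)$ be admissible, i.e. $a>0>b$ and the pair $(c,d)$ satisfies one of: $d=\bar c\in\mathbb C\setminus\mathbb R$; or $aq^m<c,d<aq^{m-1}$ for some $m\in\mathbb Z$; or $bq^{m-1}<c,d<bq^m$ for some $m\in\mathbb Z$. Then for every partition $\lambda$, $$\Phi^{bqJ}_\lambda(X;q;a,b,c,d)=\lim_{\varepsilon\to0}\varepsilon^{|\lambda|}\,\Phi^{qR}_\lambda\left(X\varepsilon^{-1};q;\varepsilon c,\varepsilon d,-\frac q{\varepsilon a},-\frac q{\varepsilon b}\right),$$ where $\varepsilon$ goes to $0$ along the grid $\{q^{k}/\sqrt{-ab}:k=1,2,\dots\}$ and the limit holds in the finite-dimensional space of symmetric functions of degree $\le|\lambda|$. Here $\Phi^{bqJ}_\lambda$ and $\Phi^{qR}_\lambda$ are the big $q$-Jacobi and $q$-Racah symmetric functions.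
   Context: Notation: $(x;q)_n=\prod_{k=0}^{n-1}(1-xq^k)$ for $n\ge0$, $(x_1,\dots,x_m;q)_n=\prod_j(x_j;q)_n$. $\ell(\lambda)$ is the number of nonzero parts, $|\lambda|=\sum\lambda_i$, $\mathbb Y(N)$ is the set of partitions with at most $N$ nonzero parts. $\mathrm{Sym}$ is the algebra of symmetric functions over $\mathbb C$, $\mathrm{Sym}(N)$ the symmetric polynomials in $N$ variables, the subscript $\le d$ means degree at most $d$. $V(x_1,\dots,x_N)=\prod_{i<j}(x_i-x_j)$. $X=(x_1,x_2,\dots)$ is the collection of variables and $F(Xr)=F(rx_1,rx_2,\dots)$, i.e. the degree-$k$ homogeneous component is multiplied by $r^k$. Convergence: $F_N\in\mathrm{Sym}(N)$ converges to $F\in\mathrm{Sym}$ if $\sup_N\deg F_N<\infty$ and, for every sufficiently large $d$, $\iota_{d,N}(F_N)\to F$ in the finite-dimensional space $\mathrm{Sym}_{\le d}$, where for $N\ge d$, $\iota_{d,N}:\mathrm{Sym}_{\le d}(N)\to\mathrm{Sym}_{\le d}$ is the inverse of the isomorphism $F\mapsto F(x_1,\dots,x_N,0,0,\dots)$. Interpolation functions: $(x\mid c_0,c_1,\dots)^m=\prod_{i=0}^{m-1}(x-c_i)$; for $\mu\in\mathbb Y(N)$, $s_{\mu|N}(x_1,\dots,x_N\mid c_0,c_1,\dots)=\det[(x_j\mid c_0,c_1,\dots)^{\mu_i+N-i}]_{i,j=1}^N/V(x_1,\dots,x_N)$. $I^A_\mu(\cdot;q)\in\mathrm{Sym}$ is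 the limit as $N\to\infty$ (which exists) of $s_{\mu|N}(\cdot\mid q^{N-1},q^{N-2},\dots)$; for $s\ne0$, $I^{BC}_\mu(\cdot;q;s)\in\mathrm{Sym}$ is the limit (which exists) of $s_{\mu|N}(\cdot\mid c^{(N)}_0,c^{(N)}_1,\dots)$ with $c_i^{(N)}=sq^i+s^{-1}q^{N-i-1}$. $q$-Racah symmetric functions: $\Phi^{qR}_\lambda(\cdot;q;s_0,s_1,s_2,s_3)=\sum_{\mu\subseteq\lambda}\sigma^{qR}(\lambda,\mu;q;s_0,s_1,s_2,s_3)\,I^{BC}_\mu(\cdot;q;s_0)$ with $$\sigma^{qR}(\lambda,\mu;q;s_0,s_1,s_2,s_3)=s_0^{|\mu|-|\lambda|}\det\left[\frac{(-s_0s_1q^{\mu_k+1-k},-s_0s_2q^{\mu_k+1-k},-s_0s_3q^{\mu_k+1-k};q)_{\lambda_j-j-\mu_k+k}}{q^{(\mu_k+1-k)(\lambda_j-j-\mu_k+k)}\,(q,\,s_0s_1s_2s_3q^{\lambda_j+\mu_k+1-j-k};q)_{\lambda_j-j-\mu_k+k}}\right]_{j,k=1}^{\ell(\lambda)}.$$ Big $q$-Jacobi symmetric functions: $\Phi^{bqJ}_\lambda(X;q;a,b,c,d)=\sum_{\mu\subseteq\lambda}\sigma^{bqJ}(\lambda,\mu;q;a,b,c,d)\,I^A_\mu(Xc;q)$ with $$\sigma^{bqJ}(\lambda,\mu;q;a,b,c,d)=c^{-|\lambda|}\det\left[\frac{\left(\frac caq^{\mu_k+2-k},\frac cbq^{\mu_k+2-k};q\right)_{\lambda_j-j-\mu_k+k}}{q^{(\mu_k+1-k)(\lambda_j-j-\mu_k+k)}\left(q,\frac{cd}{ab}q^{\lambda_j+\mu_k+3-j-k};q\right)_{\lambda_j-j-\mu_k+k}}\right]_{j,k=1}^{\ell(\lambda)}.$$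 In both determinants an entry with $\lambda_j-j-\mu_k+k<0$ is $0$, and the empty determinant is $1$. *)

theory Defs
  imports
    "HOL-Library.Poly_Mapping"
    "HOL-Combinatorics.Permutations"
    "HOL-Analysis.Function_Topology"
    "Jordan_Normal_Form.Determinant"
begin

text \<open>The parts are numbered from 0, so the part usually called \<open>\<lambda>\<^sub>j\<close> is \<^term>\<open>lam (j - 1)\<close>.\<close>

definition is_partition :: "(nat \<Rightarrow> nat) \<Rightarrow> bool" where
  "is_partition lam \<longleftrightarrow> antimono lam \<and> finite {i. lam i \<noteq> 0}"

definition plength :: "(nat \<Rightarrow> nat) \<Rightarrow> nat" where
  "plength lam = card {i. lam i \<noteq> 0}"

definition psize :: "(nat \<Rightarrow> nat) \<Rightarrow> nat" where
  "psize lam = (\<Sum>i | lam i \<noteq> 0. lam i)"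

definition subpartitions :: "(nat \<Rightarrow> nat) \<Rightarrow> (nat \<Rightarrow> nat) set" where
  "subpartitions lam = {mu. is_partition mu \<and> (\<forall>i. mu i \<le> lam i)}"

text \<open>
  A polynomial in \<open>x\<^sub>0, x\<^sub>1, \<dots>\<close> is a finitely supported map from exponent vectors to coefficients.
  An element of Sym is a formal power series of bounded degree in infinitely many variables, given
  by its function of coefficients on exponent vectors.
\<close>

type_synonym expo = "nat \<Rightarrow>\<^sub>0 nat"
type_synonym cpoly = "expo \<Rightarrow>\<^sub>0 complex"
type_synonym symfun = "expo \<Rightarrow> complex"

definition expo_deg :: "expo \<Rightarrow> nat" where
  "expo_deg m = (\<Sum>i\<in>Poly_Mapping.keys m. Poly_Mapping.lookup m i)"

definition Var :: "nat \<Rightarrow> cpoly" where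
  "Var i = Poly_Mapping.single (Poly_Mapping.single i 1) 1"

definition Const :: "complex \<Rightarrow> cpoly" where
  "Const z = Poly_Mapping.single 0 z"

text \<open>\<open>Sym\<^sub>\<le>\<^sub>d(N)\<close>, with variables \<open>x\<^sub>0, \<dots>, x\<^sub>N\<^sub>-\<^sub>1\<close>.\<close>

definition SymN_le :: "nat \<Rightarrow> nat \<Rightarrow> cpoly set" where
  "SymN_le d N = {p.
     (\<forall>m. Poly_Mapping.lookup p m \<noteq> 0 \<longrightarrow> Poly_Mapping.keys m \<subseteq> {..<N} \<and> expo_deg m \<le> d) \<and>
     (\<forall>\<pi> m. \<pi> permutes {..<N} \<longrightarrow>
        Poly_Mapping.lookup p (Poly_Mapping.map_key \<pi> m) = Poly_Mapping.lookup p m)}"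

definition Sym_le :: "nat \<Rightarrow> symfun set" where
  "Sym_le d = {F.
     (\<forall>m. F m \<noteq> 0 \<longrightarrow> expo_deg m \<le> d) \<and>
     (\<forall>n \<pi> m. \<pi> permutes {..<n} \<longrightarrow> F (Poly_Mapping.map_key \<pi> m) = F m)}"

definition Sym :: "symfun set" where
  "Sym = (\<Union>d. Sym_le d)"

text \<open>\<open>F \<mapsto> F(x\<^sub>0, \<dots>, x\<^sub>N\<^sub>-\<^sub>1, 0, 0, \<dots>)\<close>.\<close>

definition restrict_vars :: "nat \<Rightarrow> symfun \<Rightarrow> cpoly" where
  "restrict_vars N F = Abs_poly_mapping (\<lambda>m. if Poly_Mapping.keys m \<subseteq> {..<N} then F m else 0)"

text \<open>Only meaningful for \<open>N \<ge> d\<close> and arguments in \<^term>\<open>SymN_le d N\<close>.\<close>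

definition sym_iota :: "nat \<Rightarrow> nat \<Rightarrow> cpoly \<Rightarrow> symfun" where
  "sym_iota d N = inv_into (Sym_le d) (restrict_vars N)"

text \<open>
  The topology of the finite-dimensional space \<open>Sym\<^sub>\<le>\<^sub>d\<close> is the one induced by the product topology
  on coefficient functions: the coefficients are the coordinates with respect to the basis of
  monomial symmetric functions, and a finite-dimensional complex vector space has only one
  Hausdorff vector space topology.
\<close>

abbreviation Sym_le_top :: "nat \<Rightarrow> symfun topology" where
  "Sym_le_top d \<equiv> top_of_set (Sym_le d)"

text \<open>
  Convergence of \<open>F\<^sub>N \<in> Sym(N)\<close> to \<open>F \<in> Sym\<close>. The terms are only constrained for large \<open>N\<close>,
  because \<open>s\<^sub>\<mu>\<^sub>|\<^sub>N\<close> below requires \<open>\<mu>\<close> to have at most \<open>N\<close> nonzero parts.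
\<close>

definition Sym_converges :: "(nat \<Rightarrow> cpoly) \<Rightarrow> symfun \<Rightarrow> bool" where
  "Sym_converges f F \<longleftrightarrow>
     F \<in> Sym \<and>
     (\<exists>D. \<forall>\<^sub>F N in sequentially. f N \<in> SymN_le D N) \<and>
     (\<forall>\<^sub>F d in sequentially. limitin (Sym_le_top d) (\<lambda>N. sym_iota d N (f N)) F sequentially)"

text \<open>\<open>F(Xr)\<close>, where \<open>X\<close> is the collection of variables.\<close>

definition sym_scale :: "complex \<Rightarrow> symfun \<Rightarrow> symfun" where
  "sym_scale r F = (\<lambda>m. r ^ expo_deg m * F m)"

definition interp_power :: "cpoly \<Rightarrow> (nat \<Rightarrow> complex) \<Rightarrow> nat \<Rightarrow> cpoly" where
  "interp_power x c m = (\<Prod>i<m. x - Const (c i))"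

definition vandermonde :: "nat \<Rightarrow> cpoly" where
  "vandermonde N = (\<Prod>j<N. \<Prod>i<j. Var i - Var j)"

text \<open>The quotient of the alternant by the Vandermonde product is a polynomial, and it is unique
  because the polynomial ring has no zero divisors.\<close>

definition interp_schur :: "(nat \<Rightarrow> nat) \<Rightarrow> nat \<Rightarrow> (nat \<Rightarrow> complex) \<Rightarrow> cpoly" where
  "interp_schur mu N c =
     (THE p. p * vandermonde N =
        Determinant.det (Matrix.mat N N
          (\<lambda>(i, j). interp_power (Var j) c (mu i + (N - 1 - i)))))"

text \<open>The nodes are also used at indices \<open>i \<ge> N\<close>, where the exponent of \<open>q\<close> is negative.\<close>

definition I_A :: "(nat \<Rightarrow> nat) \<Rightarrow> complex \<Rightarrow> symfun" where
  "I_A mu q = (THE F. Sym_converges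
     (\<lambda>N. interp_schur mu N (\<lambda>i. q powi (int N - 1 - int i))) F)"

definition I_BC :: "(nat \<Rightarrow> nat) \<Rightarrow> complex \<Rightarrow> complex \<Rightarrow> symfun" where
  "I_BC mu q s = (THE F. Sym_converges
     (\<lambda>N. interp_schur mu N (\<lambda>i. s * q ^ i + inverse s * q powi (int N - int i - 1))) F)"

definition qpoch :: "complex \<Rightarrow> complex \<Rightarrow> nat \<Rightarrow> complex" where
  "qpoch x q n = (\<Prod>k<n. 1 - x * q ^ k)"

text \<open>
  In both coefficients the \<open>(j, k)\<close> entry of the determinant depends only on
  \<open>l = \<lambda>\<^sub>j - j\<close> and \<open>m = \<mu>\<^sub>k - k\<close>, where \<open>j\<close> and \<open>k\<close> are counted from 1.
\<close>

definition qR_entry ::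
    "complex \<Rightarrow> complex \<Rightarrow> complex \<Rightarrow> complex \<Rightarrow> complex \<Rightarrow> int \<Rightarrow> int \<Rightarrow> complex" where
  "qR_entry q s0 s1 s2 s3 l m =
     (if l - m < 0 then 0
      else let n = nat (l - m) in
        (qpoch (- s0 * s1 * q powi (m + 1)) q n * qpoch (- s0 * s2 * q powi (m + 1)) q n
           * qpoch (- s0 * s3 * q powi (m + 1)) q n)
        / (q powi ((m + 1) * (l - m))
           * (qpoch q q n * qpoch (s0 * s1 * s2 * s3 * q powi (l + m + 1)) q n)))"

definition sigma_qR ::
    "(nat \<Rightarrow> nat) \<Rightarrow> (nat \<Rightarrow> nat) \<Rightarrow> complex \<Rightarrow> complex \<Rightarrow> complex \<Rightarrow> complex \<Rightarrow> complex \<Rightarrow> complex" where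
  "sigma_qR lam mu q s0 s1 s2 s3 =
     s0 powi (int (psize mu) - int (psize lam)) *
     Determinant.det (Matrix.mat (plength lam) (plength lam)
       (\<lambda>(j, k). qR_entry q s0 s1 s2 s3 (int (lam j) - int (j + 1)) (int (mu k) - int (k + 1))))"

definition Phi_qR ::
    "(nat \<Rightarrow> nat) \<Rightarrow> complex \<Rightarrow> complex \<Rightarrow> complex \<Rightarrow> complex \<Rightarrow> complex \<Rightarrow> symfun" where
  "Phi_qR lam q s0 s1 s2 s3 =
     (\<lambda>x. \<Sum>mu\<in>subpartitions lam. sigma_qR lam mu q s0 s1 s2 s3 * I_BC mu q s0 x)"

definition bqJ_entry ::
    "complex \<Rightarrow> complex \<Rightarrow> complex \<Rightarrow> complex \<Rightarrow> complex \<Rightarrow> int \<Rightarrow> int \<Rightarrow> complex" where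
  "bqJ_entry q a b c d l m =
     (if l - m < 0 then 0
      else let n = nat (l - m) in
        (qpoch (c / a * q powi (m + 2)) q n * qpoch (c / b * q powi (m + 2)) q n)
        / (q powi ((m + 1) * (l - m))
           * (qpoch q q n * qpoch (c * d / (a * b) * q powi (l + m + 3)) q n)))"

definition sigma_bqJ ::
    "(nat \<Rightarrow> nat) \<Rightarrow> (nat \<Rightarrow> nat) \<Rightarrow> complex \<Rightarrow> complex \<Rightarrow> complex \<Rightarrow> complex \<Rightarrow> complex \<Rightarrow> complex" where
  "sigma_bqJ lam mu q a b c d =
     c powi (- int (psize lam)) *
     Determinant.det (Matrix.mat (plength lam) (plength lam)
       (\<lambda>(j, k). bqJ_entry q a b c d (int (lam j) - int (j + 1)) (int (mu k) - int (k + 1))))"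

definition Phi_bqJ ::
    "(nat \<Rightarrow> nat) \<Rightarrow> complex \<Rightarrow> complex \<Rightarrow> complex \<Rightarrow> complex \<Rightarrow> complex \<Rightarrow> symfun" where
  "Phi_bqJ lam q a b c d =
     (\<lambda>x. \<Sum>mu\<in>subpartitions lam. sigma_bqJ lam mu q a b c d * sym_scale c (I_A mu q) x)"

definition admissible :: "real \<Rightarrow> real \<Rightarrow> real \<Rightarrow> complex \<Rightarrow> complex \<Rightarrow> bool" where
  "admissible q a b c d \<longleftrightarrow>
     a > 0 \<and> b < 0 \<and>
     ((d = cnj c \<and> c \<notin> \<real>) \<or>
      (\<exists>m::int. \<forall>z\<in>{c, d}. z \<in> \<real> \<and> a * q powi m < Re z \<and> Re z < a * q powi (m - 1)) \<or>
      (\<exists>m::int. \<forall>z\<in>{c, d}. z \<in> \<real> \<and> b * q powi (m - 1) < Re z \<and> Re z < b * q powi m))"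

end

theory Submission
  imports Defs "HOL-Computational_Algebra.Formal_Power_Series"
begin

text \<open>
  Factoring the alternant \<open>[(x\<^sub>j | c)\<^sup>\<mu>\<^sup>i\<^sup>+\<^sup>N\<^sup>-\<^sup>i]\<close> through the generating functions of the elementary
  polynomials in the nodes and of the complete homogeneous polynomials in the variables gives a
  Jacobi-Trudi determinant of size \<open>\<ell>(\<mu>)\<close> for \<open>s\<^sub>\<mu>\<^sub>|\<^sub>N\<close>. It depends on \<open>N\<close> only through the elementary
  polynomials of the nodes, so it makes sense in Sym and it converges as soon as these do. For the
  nodes \<open>\<sigma>q\<^sup>i + \<tau>q\<^sup>N\<^sup>-\<^sup>1\<^sup>-\<^sup>i\<close> the power sums have explicit limits, polynomial in \<open>\<sigma>\<close> and \<open>\<tau>\<close>, and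
  Newton's identities carry this over to the elementary polynomials. The limit \<open>I(\<sigma>, \<tau>)\<close> contains
  both families: \<open>I\<^sup>A\<close> is \<open>I(0, 1)\<close> and \<open>I\<^sup>B\<^sup>C\<close> is \<open>I(s, 1/s)\<close>. It is homogeneous jointly in \<open>X\<close>, \<open>\<sigma>\<close>, \<open>\<tau>\<close>,
  hence \<open>\<epsilon>\<^bsup>|\<mu>|\<^esup> I(\<epsilon>c, 1/(\<epsilon>c))(X/\<epsilon>) = I(\<epsilon>\<^sup>2c, 1/c)(X)\<close>, which is continuous at \<open>\<epsilon> = 0\<close>.
\<close>

section \<open>Factorisation of alternants\<close>

text \<open>The polynomial \<open>\<Sum>k. (-1)^k e_k(c) X^k\<close> of the first n nodes. With the
  signs inside the coefficients, no alternating sign appears in the matrix entries below.\<close>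

definition efps :: "(nat \<Rightarrow> 'a) \<Rightarrow> nat \<Rightarrow> 'a::comm_ring_1 fps" where
  "efps c n = (\<Prod>t<n. 1 - fps_const (c t) * fps_X)"

lemma fps_nth_mult_linear:
  fixes F :: "'a::comm_ring_1 fps"
  shows "fps_nth (F * (1 - fps_const a * fps_X)) 0 = fps_nth F 0"
    and "fps_nth (F * (1 - fps_const a * fps_X)) (Suc k) = fps_nth F (Suc k) - a * fps_nth F k"
proof -
  have *: "F * (1 - fps_const a * fps_X) = F - fps_const a * (F * fps_X)"
    by (simp add: algebra_simps)
  show "fps_nth (F * (1 - fps_const a * fps_X)) 0 = fps_nth F 0"
    unfolding * by simp
  show "fps_nth (F * (1 - fps_const a * fps_X)) (Suc k) = fps_nth F (Suc k) - a * fps_nth F k"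
    unfolding * by simp
qed

lemma fps_nth_prod_linear_beyond:
  fixes c :: "'b \<Rightarrow> 'a::comm_ring_1"
  assumes "finite A" "card A < k"
  shows "fps_nth (\<Prod>t\<in>A. 1 - fps_const (c t) * fps_X) k = 0"
  using assms
proof (induction A arbitrary: k rule: finite_induct)
  case empty
  then show ?case by simp
next
  case (insert a A)
  then obtain k' where k': "k = Suc k'" "card A < k'"
    by (cases k) auto
  have "fps_nth (\<Prod>t\<in>insert a A. 1 - fps_const (c t) * fps_X) k =
        fps_nth ((\<Prod>t\<in>A. 1 - fps_const (c t) * fps_X) * (1 - fps_const (c a) * fps_X)) (Suc k')"
    using insert.hyps k' by (simp add: mult.commute)
  then show ?case
    unfolding fps_nth_mult_linear using insert.IH k' by simp
qed

lemma efps_Suc: "efps c (Suc n) = efps c n * (1 - fps_const (c n) * fps_X)"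
  by (simp add: efps_def)

lemma efps_0 [simp]: "efps c 0 = 1"
  by (simp add: efps_def)

lemma efps_nth_0: "fps_nth (efps c n) 0 = 1"
  by (induction n) (simp_all add: efps_Suc fps_nth_mult_linear del: fps_mult_nth_0)

lemma efps_nth_beyond: "n < k \<Longrightarrow> fps_nth (efps c n) k = 0"
  unfolding efps_def by (rule fps_nth_prod_linear_beyond) auto

lemma geometric_fps_mult:
  fixes x :: "'a::comm_ring_1"
  shows "Abs_fps (\<lambda>p. x ^ p) * (1 - fps_const x * fps_X) = 1"
proof (rule fps_ext)
  fix k show "fps_nth (Abs_fps (\<lambda>p. x ^ p) * (1 - fps_const x * fps_X)) k = fps_nth 1 k"
    by (cases k) (simp_all only: fps_nth_mult_linear, simp_all)
qed

text \<open>The coefficient at n collects the products \<open>(-1)^k e_k(c) x^(n-k)\<close>. In the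
  induction step, the coefficient of F at n + 1 is x times the one at n, because
  \<open>efps c n\<close> has degree at most n.\<close>

lemma efps_geometric_nth:
  fixes x :: "'a::comm_ring_1"
  shows "fps_nth (efps c n * Abs_fps (\<lambda>p. x ^ p)) n = (\<Prod>t<n. x - c t)"
proof (induction n)
  case 0
  then show ?case by simp
next
  case (Suc n)
  define F where "F = efps c n * Abs_fps (\<lambda>p. x ^ p)"
  have "F * (1 - fps_const x * fps_X) = efps c n"
    unfolding F_def mult.assoc geometric_fps_mult by simp
  then have "fps_nth F (Suc n) - x * fps_nth F n = 0"
    using fps_nth_mult_linear(2)[of F x n] efps_nth_beyond[of n "Suc n" c] by simp
  moreover have "efps c (Suc n) * Abs_fps (\<lambda>p. x ^ p) = F * (1 - fps_const (c n) * fps_X)"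
    by (simp add: F_def efps_Suc mult_ac)
  then have "fps_nth (efps c (Suc n) * Abs_fps (\<lambda>p. x ^ p)) (Suc n) =
      fps_nth F (Suc n) - c n * fps_nth F n"
    by (simp only: fps_nth_mult_linear)
  ultimately have "fps_nth (efps c (Suc n) * Abs_fps (\<lambda>p. x ^ p)) (Suc n) =
      fps_nth F n * (x - c n)"
    by (simp add: algebra_simps)
  then show ?case
    using Suc.IH by (simp add: F_def)
qed

text \<open>Signed elementary polynomials in the variables other than \<open>x j\<close>, the degree
  falling from N - 1 in the first row to 0 in the last.\<close>

definition omit_mat :: "(nat \<Rightarrow> 'a) \<Rightarrow> nat \<Rightarrow> 'a::comm_ring_1 mat" where
  "omit_mat x N = mat N N (\<lambda>(k, j).
     fps_nth (\<Prod>i\<in>{..<N} - {j}. 1 - fps_const (x i) * fps_X) (N - 1 - k))"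

text \<open>When G generates the complete homogeneous polynomials h, the entry is
  \<open>\<Sum>r. (-1)^r e_r h_(mu i - i + k - r)\<close>, a Jacobi-Trudi entry deformed by the
  nodes. The test \<open>i \<le> mu i + k\<close> replaces the convention that h vanishes at
  negative indices.\<close>

definition coeff_mat :: "'a::comm_ring_1 fps \<Rightarrow> (nat \<Rightarrow> nat \<Rightarrow> 'a) \<Rightarrow> (nat \<Rightarrow> nat) \<Rightarrow> nat \<Rightarrow> 'a mat" where
  "coeff_mat G c mu N = mat N N (\<lambda>(i, k).
     if i \<le> mu i + k then fps_nth (efps (c i) (mu i + (N - 1 - i)) * G) (mu i + k - i) else 0)"

text \<open>G cancels every factor of \<open>efps x N\<close>, so times the product M without j it
  is the geometric series of \<open>x j\<close>. By \<open>efps_geometric_nth\<close> the left side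
  is a coefficient of \<open>efps c n * G * M\<close>, and the right side is its Cauchy
  product.\<close>

lemma prod_nodes_eq_sum:
  fixes x :: "nat \<Rightarrow> 'a::comm_ring_1"
  assumes G: "G * efps x N = 1" and j: "j < N"
  shows "(\<Prod>t<n. x j - c t) =
    (\<Sum>k<N. if N - 1 - k \<le> n
      then fps_nth (efps c n * G) (n - (N - 1 - k)) *
        fps_nth (\<Prod>i\<in>{..<N} - {j}. 1 - fps_const (x i) * fps_X) (N - 1 - k)
      else 0)"
proof -
  define M where "M = (\<Prod>i\<in>{..<N} - {j}. 1 - fps_const (x i) * fps_X)"
  define \<Gamma> where "\<Gamma> = Abs_fps (\<lambda>p. x j ^ p)"
  have E: "efps x N = (1 - fps_const (x j) * fps_X) * M"
    unfolding efps_def M_def using j by (intro prod.remove) auto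
  have "G * M = G * M * (\<Gamma> * (1 - fps_const (x j) * fps_X))"
    by (simp add: \<Gamma>_def geometric_fps_mult)
  also have "\<dots> = \<Gamma> * (G * efps x N)"
    by (simp add: E mult_ac)
  finally have GM: "G * M = \<Gamma>"
    using G by simp
  define f where "f p = (if p \<le> n then fps_nth (efps c n * G) (n - p) * fps_nth M p else 0)" for p
  have M0: "fps_nth M p = 0" if "N \<le> p" for p
    unfolding M_def using that j by (intro fps_nth_prod_linear_beyond) auto
  have f0: "p < N" if "f p \<noteq> 0" for p
    using that M0[of p] by (cases "p < N") (auto simp: f_def split: if_splits)
  have "(\<Prod>t<n. x j - c t) = fps_nth (efps c n * G * M) n"
    unfolding mult.assoc GM unfolding \<Gamma>_def by (simp add: efps_geometric_nth)
  also have "\<dots> = (\<Sum>p\<le>n. fps_nth (efps c n * G) (n - p) * fps_nth M p)"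
    by (subst mult.commute) (simp add: fps_mult_nth atLeast0AtMost mult.commute)
  also have "\<dots> = (\<Sum>p\<le>n. f p)"
    by (rule sum.cong) (auto simp: f_def)
  \<comment> \<open>M has degree below N and f is 0 beyond n, so the range \<open>p \<le> n\<close>
    is exchanged for \<open>p < N\<close> through the intersection.\<close>
  also have "\<dots> = (\<Sum>p\<in>{..n} \<inter> {..<N}. f p)"
    by (rule sum.mono_neutral_right) (auto dest: f0)
  also have "\<dots> = (\<Sum>p<N. f p)"
    by (rule sum.mono_neutral_left) (auto simp: f_def)
  also have "\<dots> = (\<Sum>k<N. f (N - 1 - k))"
    by (rule sum.reindex_bij_witness[of _ "\<lambda>k. N - 1 - k" "\<lambda>k. N - 1 - k"]) auto
  finally show ?thesis
    unfolding f_def M_def .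
qed

text \<open>This is \<open>prod_nodes_eq_sum\<close> with \<open>n = mu i + (N - 1 - i)\<close> in
  row i; there \<open>n - (N - 1 - k)\<close> equals \<open>mu i + k - i\<close>.\<close>

lemma alternant_factor:
  fixes x :: "nat \<Rightarrow> 'a::comm_ring_1"
  assumes G: "G * efps x N = 1"
  shows "mat N N (\<lambda>(i, j). \<Prod>t<mu i + (N - 1 - i). x j - c i t) = coeff_mat G c mu N * omit_mat x N"
proof (rule eq_matI)
  fix i j assume "i < dim_row (coeff_mat G c mu N * omit_mat x N)"
    "j < dim_col (coeff_mat G c mu N * omit_mat x N)"
  then have ij: "i < N" "j < N"
    by (auto simp: coeff_mat_def omit_mat_def)
  have "(coeff_mat G c mu N * omit_mat x N) $$ (i, j) =
      (\<Sum>k<N. coeff_mat G c mu N $$ (i, k) * omit_mat x N $$ (k, j))"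
    using ij by (simp add: coeff_mat_def omit_mat_def scalar_prod_def lessThan_atLeast0)
  also have "\<dots> = (\<Prod>t<mu i + (N - 1 - i). x j - c i t)"
    unfolding prod_nodes_eq_sum[OF G ij(2)]
  proof (rule sum.cong)
    fix k assume "k \<in> {..<N}"
    then have k: "k < N" by simp
    have "(N - 1 - k \<le> mu i + (N - 1 - i)) = (i \<le> mu i + k)"
      "mu i + (N - 1 - i) - (N - 1 - k) = mu i + k - i"
      using ij k by auto
    then show "coeff_mat G c mu N $$ (i, k) * omit_mat x N $$ (k, j) =
      (if N - 1 - k \<le> mu i + (N - 1 - i)
       then fps_nth (efps (c i) (mu i + (N - 1 - i)) * G) (mu i + (N - 1 - i) - (N - 1 - k)) *
        fps_nth (\<Prod>i\<in>{..<N} - {j}. 1 - fps_const (x i) * fps_X) (N - 1 - k)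
       else 0)"
      using ij k by (simp add: coeff_mat_def omit_mat_def)
  qed simp
  finally show "mat N N (\<lambda>(i, j). \<Prod>t<mu i + (N - 1 - i). x j - c i t) $$ (i, j) =
      (coeff_mat G c mu N * omit_mat x N) $$ (i, j)"
    using ij by simp
qed (auto simp: coeff_mat_def omit_mat_def)

text \<open>Rows from l on have 0 left of the diagonal and 1 on it, so the matrix is block upper
  triangular with a unitriangular lower right block. This makes the size of the determinant
  independent of N.\<close>

lemma det_coeff_mat:
  fixes G :: "'a::idom fps"
  assumes G0: "fps_nth G 0 = 1" and l: "l \<le> N" and mu: "\<And>i. l \<le> i \<Longrightarrow> mu i = 0"
  shows "Determinant.det (coeff_mat G c mu N) = Determinant.det (mat l l (\<lambda>(i, k).
     if i \<le> mu i + k then fps_nth (efps (c i) (mu i + (N - 1 - i)) * G) (mu i + k - i) else 0))"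
    (is "_ = Determinant.det ?A")
proof -
  let ?C = "coeff_mat G c mu N"
  define B where "B = mat l (N - l) (\<lambda>(i, k). ?C $$ (i, l + k))"
  define D where "D = mat (N - l) (N - l) (\<lambda>(i, k). ?C $$ (l + i, l + k))"
  have "?C = four_block_mat ?A B (0\<^sub>m (N - l) l) D"
    by (rule eq_matI) (use l mu in \<open>auto simp: coeff_mat_def B_def D_def\<close>)
  then have "Determinant.det ?C = Determinant.det ?A * Determinant.det D"
    using det_four_block_mat_lower_left_zero[of ?A l B "N - l" "0\<^sub>m (N - l) l" D]
    by (simp add: B_def D_def)
  moreover have "Determinant.det D = prod_list (diag_mat D)"
    by (rule det_upper_triangular[of _ "N - l"])
      (use l mu in \<open>auto simp: D_def coeff_mat_def upper_triangular_def\<close>)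
  moreover have "diag_mat D = map (\<lambda>i. 1) [0..<N - l]"
    unfolding diag_mat_def
    by (rule map_cong) (use l mu G0 in \<open>auto simp: D_def coeff_mat_def efps_nth_0\<close>)
  ultimately show ?thesis
    by (simp add: map_replicate_const prod_list_replicate)
qed

text \<open>With the variables themselves as nodes, in reverse order, the alternant is triangular.\<close>

lemma det_omit_mat:
  fixes x :: "nat \<Rightarrow> 'a::idom"
  assumes G: "G * efps x N = 1"
  shows "Determinant.det (omit_mat x N) = (\<Prod>j<N. \<Prod>i<j. x i - x j)"
proof -
  define c where "c t = x (N - 1 - t)" for t
  let ?L = "mat N N (\<lambda>(i, j). \<Prod>t<0 + (N - 1 - i). x j - c t)"
  have G0: "fps_nth G 0 = 1"
    using arg_cong[OF G, of "\<lambda>F. fps_nth F 0"] by (simp add: efps_nth_0)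
  \<comment> \<open>With the nodes reversed, the entry in row i and column j contains the factor
    \<open>x j - x j\<close> exactly when \<open>i < j\<close>, so the alternant is lower
    triangular.\<close>
  have L: "(\<Prod>t<N - Suc i. x j - c t) = (\<Prod>k\<in>{i<..<N}. x j - x k)" for i j
    unfolding c_def
    by (rule prod.reindex_bij_witness[of _ "\<lambda>k. N - 1 - k" "\<lambda>k. N - 1 - k"]) auto
  have "Determinant.det ?L = Determinant.det (coeff_mat G (\<lambda>_. c) (\<lambda>_. 0) N) * Determinant.det (omit_mat x N)"
    unfolding alternant_factor[OF G, where mu = "\<lambda>_. 0" and c = "\<lambda>_. c"]
    by (rule det_mult[of _ N]) (auto simp: coeff_mat_def omit_mat_def)
  \<comment> \<open>\<open>det_coeff_mat\<close> with \<open>l = 0\<close> ends in the empty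
    determinant.\<close>
  also have "Determinant.det (coeff_mat G (\<lambda>_. c) (\<lambda>_. 0) N) = 1"
    by (subst det_coeff_mat[of _ 0]) (use G0 in auto)
  finally have "Determinant.det (omit_mat x N) = Determinant.det ?L"
    by simp
  also have "\<dots> = prod_list (diag_mat ?L)"
    by (rule det_lower_triangular[of N]) (auto simp: L intro!: prod_zero)
  also have "\<dots> = (\<Prod>i<N. \<Prod>k\<in>{i<..<N}. x i - x k)"
    by (simp add: diag_mat_def L prod.distinct_set_conv_list[symmetric] atLeast0LessThan)
  also have "\<dots> = (\<Prod>j<N. \<Prod>i<j. x i - x j)"
    by (subst (1 2) prod.Sigma)
      (auto intro!: prod.reindex_bij_witness[of _ "\<lambda>(a, b). (b, a)" "\<lambda>(a, b). (b, a)"])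
  finally show ?thesis .
qed

section \<open>Symmetric functions as coefficient functions\<close>

lemma expo_deg_superset:
  assumes "finite A" "Poly_Mapping.keys m \<subseteq> A"
  shows "expo_deg m = (\<Sum>i\<in>A. Poly_Mapping.lookup m i)"
  unfolding expo_deg_def using assms
  by (intro sum.mono_neutral_left) (auto simp: in_keys_iff)

lemma expo_deg_0 [simp]: "expo_deg 0 = 0"
  by (simp add: expo_deg_def)

lemma keys_add_expo: "Poly_Mapping.keys (a + b :: expo) = Poly_Mapping.keys a \<union> Poly_Mapping.keys b"
  by (auto simp: in_keys_iff lookup_add)

lemma expo_deg_add: "expo_deg (a + b) = expo_deg a + expo_deg b"
proof -
  let ?A = "Poly_Mapping.keys a \<union> Poly_Mapping.keys b"
  have "expo_deg (a + b) = (\<Sum>i\<in>?A. Poly_Mapping.lookup (a + b) i)"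
    by (rule expo_deg_superset) (auto simp: keys_add_expo)
  then show ?thesis
    using expo_deg_superset[of ?A a] expo_deg_superset[of ?A b]
    by (simp add: lookup_add sum.distrib)
qed

lemma expo_deg_map_key:
  assumes "bij \<pi>"
  shows "expo_deg (Poly_Mapping.map_key \<pi> m) = expo_deg m"
proof -
  have inj: "inj \<pi>"
    using assms by (rule bij_is_inj)
  have "bij_betw \<pi> (\<pi> -` Poly_Mapping.keys m) (Poly_Mapping.keys m)"
    using assms by (auto simp: bij_betw_def inj_on_def bij_def surj_image_vimage_eq)
  then show ?thesis
    unfolding expo_deg_def keys_map_key[OF inj] map_key.rep_eq[OF inj]
    by (auto intro: sum.reindex_bij_betw)
qed

lemma lookup_le_expo_deg: "Poly_Mapping.lookup m i \<le> expo_deg m"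
proof (cases "i \<in> Poly_Mapping.keys m")
  case True
  then show ?thesis
    unfolding expo_deg_def by (intro member_le_sum) auto
qed (simp add: in_keys_iff)

text \<open>Gives finite support to \<open>restrict_vars\<close> and finiteness to
  \<open>splits\<close>. A vector is recovered from its first N exponents, each of which is at most
  d.\<close>

lemma finite_expos:
  "finite {m :: expo. Poly_Mapping.keys m \<subseteq> {..<N} \<and> expo_deg m \<le> d}" (is "finite ?S")
proof (rule finite_imageD)
  let ?f = "\<lambda>m :: expo. map (Poly_Mapping.lookup m) [0..<N]"
  have "?f ` ?S \<subseteq> {xs. set xs \<subseteq> {..d} \<and> length xs = N}"
    by (auto intro: order_trans[OF lookup_le_expo_deg])
  then show "finite (?f ` ?S)"
    by (rule finite_subset) (simp add: finite_lists_length_eq)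
  show "inj_on ?f ?S"
  proof (rule inj_onI)
    fix a b assume ab: "a \<in> ?S" "b \<in> ?S" and eq: "?f a = ?f b"
    show "a = b"
    proof (rule poly_mapping_eqI)
      fix i
      show "Poly_Mapping.lookup a i = Poly_Mapping.lookup b i"
      proof (cases "i < N")
        case True
        then show ?thesis using eq by (auto simp: map_eq_conv)
      next
        case False
        then have "i \<notin> Poly_Mapping.keys a" "i \<notin> Poly_Mapping.keys b"
          using ab by auto
        then show ?thesis by (simp add: in_keys_iff)
      qed
    qed
  qed
qed

definition splits :: "expo \<Rightarrow> (expo \<times> expo) set" where
  "splits m = {(a, b). a + b = m}"

lemma expo_keys_bounded: "\<exists>N. Poly_Mapping.keys (m :: expo) \<subseteq> {..<N}"
  using finite_nat_iff_bounded[of "Poly_Mapping.keys m"] by simp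

lemma finite_splits: "finite (splits m)"
proof -
  obtain N where N: "Poly_Mapping.keys m \<subseteq> {..<N}"
    using expo_keys_bounded by blast
  let ?S = "{a :: expo. Poly_Mapping.keys a \<subseteq> {..<N} \<and> expo_deg a \<le> expo_deg m}"
  have "splits m \<subseteq> ?S \<times> ?S"
    using N by (auto simp: splits_def keys_add_expo expo_deg_add)
  then show ?thesis
    by (rule finite_subset) (simp add: finite_expos)
qed

text \<open>Brings the product of polynomials into the shape of the product \<open>conv\<close> of
  power series.\<close>

lemma lookup_mult_splits:
  fixes p r :: cpoly
  shows "Poly_Mapping.lookup (p * r) m =
    (\<Sum>(a, b)\<in>splits m. Poly_Mapping.lookup p a * Poly_Mapping.lookup r b)"
proof -
  have "Poly_Mapping.lookup (p * r) m =
      (\<Sum>(a, b). Poly_Mapping.lookup p a * Poly_Mapping.lookup r b when m = a + b)"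
    unfolding times_poly_mapping.rep_eq by (rule prod_fun_unfold_prod) auto
  also have "\<dots> = (\<Sum>(a, b)\<in>splits m. Poly_Mapping.lookup p a * Poly_Mapping.lookup r b when m = a + b)"
    by (rule Sum_any.expand_superset) (simp add: finite_splits, auto simp: splits_def when_def split: if_splits)
  also have "\<dots> = (\<Sum>(a, b)\<in>splits m. Poly_Mapping.lookup p a * Poly_Mapping.lookup r b)"
    by (rule sum.cong) (auto simp: splits_def)
  finally show ?thesis .
qed

lemma lookup_Const_mult:
  "Poly_Mapping.lookup (Const z * p) m = z * Poly_Mapping.lookup p m"
proof -
  have "Poly_Mapping.lookup (Const z * p) m =
      (\<Sum>(a, b)\<in>splits m. if (a, b) = (0, m) then z * Poly_Mapping.lookup p m else 0)"
    unfolding lookup_mult_splits Const_def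
    by (rule sum.cong) (auto simp: splits_def lookup_single when_def)
  also have "\<dots> = (\<Sum>s\<in>splits m. if s = (0, m) then z * Poly_Mapping.lookup p m else 0)"
    by (simp add: case_prod_unfold prod_eq_iff)
  also have "\<dots> = z * Poly_Mapping.lookup p m"
    by (subst sum.delta[OF finite_splits]) (auto simp: splits_def)
  finally show ?thesis .
qed

lemma Const_of_int: "Const (of_int z) = of_int z"
  by (simp add: Const_def)

lemma Const_mult: "Const (y * z) = Const y * Const z"
  by (simp add: Const_def mult_single)

lemma Const_diff: "Const (y - z) = Const y - Const z"
  by (simp add: Const_def single_diff)

section \<open>Closure properties of the spaces \<open>Sym_le d\<close>\<close>

lemma Sym_leI:
  assumes "\<And>m. F m \<noteq> 0 \<Longrightarrow> expo_deg m \<le> d"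
    and "\<And>n \<pi> m. \<pi> permutes {..<n} \<Longrightarrow> F (Poly_Mapping.map_key \<pi> m) = F m"
  shows "F \<in> Sym_le d"
  using assms by (auto simp: Sym_le_def)

lemma Sym_leD:
  assumes "F \<in> Sym_le d"
  shows "F m \<noteq> 0 \<Longrightarrow> expo_deg m \<le> d"
    and "\<pi> permutes {..<n :: nat} \<Longrightarrow> F (Poly_Mapping.map_key \<pi> m) = F m"
  using assms by (auto simp: Sym_le_def)

lemma Sym_le_mono: "F \<in> Sym_le d \<Longrightarrow> d \<le> e \<Longrightarrow> F \<in> Sym_le e"
  by (fastforce simp: Sym_le_def)

lemma Sym_le_zero: "(\<lambda>m. 0) \<in> Sym_le d"
  by (simp add: Sym_le_def)

lemma Sym_le_sum:
  assumes F: "\<And>i. i \<in> A \<Longrightarrow> F i \<in> Sym_le d"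
  shows "(\<lambda>m. \<Sum>i\<in>A. F i m) \<in> Sym_le d"
proof (rule Sym_leI)
  fix m assume "(\<Sum>i\<in>A. F i m) \<noteq> 0"
  then obtain i where "i \<in> A" "F i m \<noteq> 0"
    by (rule sum.not_neutral_contains_not_neutral)
  then show "expo_deg m \<le> d"
    using Sym_leD(1)[OF F] by blast
next
  fix n m and \<pi> :: "nat \<Rightarrow> nat"
  assume "\<pi> permutes {..<n}"
  then show "(\<Sum>i\<in>A. F i (Poly_Mapping.map_key \<pi> m)) = (\<Sum>i\<in>A. F i m)"
    by (intro sum.cong) (auto simp: Sym_leD(2)[OF F])
qed

lemma Sym_le_cmult: "F \<in> Sym_le d \<Longrightarrow> (\<lambda>m. z * F m) \<in> Sym_le d"
  using Sym_leD[of F d] by (intro Sym_leI) auto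

lemma sym_scale_Sym_le: "F \<in> Sym_le d \<Longrightarrow> sym_scale r F \<in> Sym_le d"
  unfolding sym_scale_def
  using Sym_leD[of F d] by (intro Sym_leI) (auto simp: expo_deg_map_key permutes_bij)

text \<open>The support is finite by \<open>finite_expos\<close>, so \<open>Abs_poly_mapping\<close>
  returns the intended polynomial.\<close>

lemma lookup_restrict_vars:
  assumes "F \<in> Sym_le d"
  shows "Poly_Mapping.lookup (restrict_vars N F) m = (if Poly_Mapping.keys m \<subseteq> {..<N} then F m else 0)"
proof -
  have "finite {m. (if Poly_Mapping.keys m \<subseteq> {..<N} then F m else 0) \<noteq> 0}"
    by (rule finite_subset[OF _ finite_expos[of N d]]) (auto dest: Sym_leD(1)[OF assms])
  then show ?thesis
    by (simp add: restrict_vars_def)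
qed

section \<open>The convolution product of symmetric functions\<close>

definition conv :: "symfun \<Rightarrow> symfun \<Rightarrow> symfun" where
  "conv F G = (\<lambda>m. \<Sum>(a, b)\<in>splits m. F a * G b)"

lemma conv_nonzeroE:
  assumes "conv F G m \<noteq> 0"
  obtains a b where "a + b = m" "F a \<noteq> 0" "G b \<noteq> 0"
proof -
  obtain s where "s \<in> splits m" "(case s of (a, b) \<Rightarrow> F a * G b) \<noteq> 0"
    using assms unfolding conv_def by (rule sum.not_neutral_contains_not_neutral)
  then show ?thesis
    using that by (auto simp: splits_def)
qed

lemma map_key_map_key_inv:
  fixes m :: expo
  assumes "bij \<pi>"
  shows "Poly_Mapping.map_key \<pi> (Poly_Mapping.map_key (inv_into UNIV \<pi>) m) = m"
    and "Poly_Mapping.map_key (inv_into UNIV \<pi>) (Poly_Mapping.map_key \<pi> m) = m"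
proof -
  have i: "inj \<pi>" "inj (inv_into UNIV \<pi>)" "inv_into UNIV \<pi> \<circ> \<pi> = id" "\<pi> \<circ> inv_into UNIV \<pi> = id"
    using assms by (auto simp: bij_is_inj bij_is_surj bij_imp_bij_inv fun_eq_iff surj_f_inv_f)
  show "Poly_Mapping.map_key \<pi> (Poly_Mapping.map_key (inv_into UNIV \<pi>) m) = m"
    "Poly_Mapping.map_key (inv_into UNIV \<pi>) (Poly_Mapping.map_key \<pi> m) = m"
    using i map_key_id[of m] by (simp_all add: map_key_compose id_def)
qed

text \<open>Acting on both components of a pair, a permutation carries \<open>splits m\<close>
  bijectively onto the splits of the permuted vector.\<close>

lemma conv_map_key:
  assumes pi: "\<pi> permutes {..<n}" and F: "F \<in> Sym_le d" and G: "G \<in> Sym_le e"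
  shows "conv F G (Poly_Mapping.map_key \<pi> m) = conv F G m"
proof -
  have bij: "bij \<pi>" and inj: "inj \<pi>" "inj (inv_into UNIV \<pi>)"
    using pi by (auto intro: permutes_bij permutes_inj permutes_inv)
  let ?f = "\<lambda>\<pi> (a, b). (Poly_Mapping.map_key \<pi> a, Poly_Mapping.map_key \<pi> b) :: expo \<times> expo"
  show ?thesis
    unfolding conv_def
  proof (rule sum.reindex_bij_witness[of _ "?f \<pi>" "?f (inv_into UNIV \<pi>)"])
    fix s assume s: "s \<in> splits (Poly_Mapping.map_key \<pi> m)"
    show "?f \<pi> (?f (inv_into UNIV \<pi>) s) = s"
      by (cases s) (simp add: map_key_map_key_inv[OF bij])
    show "?f (inv_into UNIV \<pi>) s \<in> splits m"
      using s map_key_map_key_inv(2)[OF bij, of m]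
      by (cases s) (simp add: splits_def flip: map_key_plus[OF inj(2)])
    show "(case ?f (inv_into UNIV \<pi>) s of (a, b) \<Rightarrow> F a * G b) = (case s of (a, b) \<Rightarrow> F a * G b)"
      using Sym_leD(2)[OF F permutes_inv[OF pi]] Sym_leD(2)[OF G permutes_inv[OF pi]]
      by (cases s) simp
  next
    fix s assume s: "s \<in> splits m"
    show "?f (inv_into UNIV \<pi>) (?f \<pi> s) = s"
      by (cases s) (simp add: map_key_map_key_inv[OF bij])
    show "?f \<pi> s \<in> splits (Poly_Mapping.map_key \<pi> m)"
      using s by (cases s) (auto simp: splits_def map_key_plus[OF inj(1)])
  qed
qed

lemma conv_Sym_le:
  assumes F: "F \<in> Sym_le d" and G: "G \<in> Sym_le e"
  shows "conv F G \<in> Sym_le (d + e)"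
proof (rule Sym_leI)
  fix m assume "conv F G m \<noteq> 0"
  then show "expo_deg m \<le> d + e"
    by (rule conv_nonzeroE) (use Sym_leD(1)[OF F] Sym_leD(1)[OF G] in \<open>auto simp: expo_deg_add intro!: add_mono\<close>)
next
  fix n m and \<pi> :: "nat \<Rightarrow> nat"
  assume "\<pi> permutes {..<n}"
  then show "conv F G (Poly_Mapping.map_key \<pi> m) = conv F G m"
    using F G by (rule conv_map_key)
qed

lemma restrict_vars_conv:
  assumes F: "F \<in> Sym_le d" and G: "G \<in> Sym_le e"
  shows "restrict_vars N (conv F G) = restrict_vars N F * restrict_vars N G"
proof (rule poly_mapping_eqI)
  fix m
  have "Poly_Mapping.lookup (restrict_vars N F * restrict_vars N G) m =
      (\<Sum>(a, b)\<in>splits m. if Poly_Mapping.keys m \<subseteq> {..<N} then F a * G b else 0)"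
    unfolding lookup_mult_splits lookup_restrict_vars[OF F] lookup_restrict_vars[OF G]
    by (rule sum.cong) (auto simp: splits_def keys_add_expo)
  then show "Poly_Mapping.lookup (restrict_vars N (conv F G)) m =
      Poly_Mapping.lookup (restrict_vars N F * restrict_vars N G) m"
    unfolding lookup_restrict_vars[OF conv_Sym_le[OF F G]] by (simp add: conv_def)
qed

section \<open>Products and determinants in the convolution algebra\<close>

definition sone :: symfun where
  "sone m = of_bool (m = 0)"

primrec sprod :: "(nat \<Rightarrow> symfun) \<Rightarrow> nat \<Rightarrow> symfun" where
  "sprod f 0 = sone"
| "sprod f (Suc n) = conv (sprod f n) (f n)"

text \<open>The Leibniz formula in the convolution algebra of formal power series, for which there is no
  ring type.\<close>

definition sdet :: "nat \<Rightarrow> (nat \<Rightarrow> nat \<Rightarrow> symfun) \<Rightarrow> symfun" where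
  "sdet n A = (\<lambda>m. \<Sum>p | p permutes {0..<n}. of_int (sign p) * sprod (\<lambda>i. A i (p i)) n m)"

lemma sone_Sym_le: "sone \<in> Sym_le 0"
proof (rule Sym_leI)
  fix n and m :: expo and \<pi> :: "nat \<Rightarrow> nat"
  assume "\<pi> permutes {..<n}"
  then have bij: "bij \<pi>" and inj: "inj \<pi>" "inj (inv_into UNIV \<pi>)"
    by (auto intro: permutes_bij permutes_inj permutes_inv)
  have "Poly_Mapping.map_key \<pi> m = 0 \<longleftrightarrow> m = 0"
    using map_key_map_key_inv(2)[OF bij, of m] map_key_zero[OF inj(1)] map_key_zero[OF inj(2)] by metis
  then show "sone (Poly_Mapping.map_key \<pi> m) = sone m"
    by (simp add: sone_def)
qed (simp add: sone_def split: if_splits)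

lemma restrict_vars_sone: "restrict_vars N sone = 1"
  unfolding poly_mapping_eq_iff fun_eq_iff lookup_restrict_vars[OF sone_Sym_le]
  by (auto simp: sone_def lookup_one)

lemma sprod_Sym_le:
  assumes "\<And>i. i < n \<Longrightarrow> f i \<in> Sym_le (d i)"
  shows "sprod f n \<in> Sym_le (\<Sum>i<n. d i)"
  using assms by (induction n) (auto intro: sone_Sym_le conv_Sym_le)

lemma restrict_vars_sprod:
  assumes "\<And>i. i < n \<Longrightarrow> f i \<in> Sym_le (d i)"
  shows "restrict_vars N (sprod f n) = (\<Prod>i<n. restrict_vars N (f i))"
  using assms
proof (induction n)
  case (Suc n)
  then show ?case
    using restrict_vars_conv[OF sprod_Sym_le[of n f d], of "f n" "d n"] by simp
qed (simp add: restrict_vars_sone)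

text \<open>\<alpha> stands on the left because the degrees \<open>\<beta> i - \<alpha> i\<close>
  allotted to the factors of a determinant term can be negative.\<close>

lemma sprod_degree_le:
  assumes "\<And>i m. i < n \<Longrightarrow> f i m \<noteq> 0 \<Longrightarrow> expo_deg m + \<alpha> i \<le> \<beta> i" and "sprod f n m \<noteq> 0"
  shows "expo_deg m + (\<Sum>i<n. \<alpha> i) \<le> (\<Sum>i<n. \<beta> i)"
  using assms
proof (induction n arbitrary: m)
  case 0
  then show ?case by (simp add: sone_def split: if_splits)
next
  case (Suc n)
  from Suc.prems(2) have "conv (sprod f n) (f n) m \<noteq> 0" by simp
  then obtain a b where ab: "a + b = m" "sprod f n a \<noteq> 0" "f n b \<noteq> 0"
    by (rule conv_nonzeroE)
  have "expo_deg a + (\<Sum>i<n. \<alpha> i) \<le> (\<Sum>i<n. \<beta> i)" "expo_deg b + \<alpha> n \<le> \<beta> n"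
    using Suc.IH[OF Suc.prems(1) ab(2)] Suc.prems(1)[of n b] ab(3) by auto
  then show ?case
    using ab(1)[symmetric] by (simp add: expo_deg_add)
qed

text \<open>Homogeneity in the same form: factor i scales by r to the power
  \<open>\<beta> i - \<alpha> i\<close>, written with natural exponents only.\<close>

lemma sprod_scale:
  fixes r :: complex
  assumes "\<And>i m. i < n \<Longrightarrow> r ^ (expo_deg m + \<alpha> i) * g i m = r ^ \<beta> i * f i m"
  shows "r ^ (expo_deg m + (\<Sum>i<n. \<alpha> i)) * sprod g n m = r ^ (\<Sum>i<n. \<beta> i) * sprod f n m"
  using assms
proof (induction n arbitrary: m)
  case 0
  then show ?case by (simp add: sone_def)
next
  case (Suc n)
  have "r ^ (expo_deg m + (\<Sum>i<Suc n. \<alpha> i)) * sprod g (Suc n) m =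
      (\<Sum>(a, b)\<in>splits m. (r ^ (expo_deg a + (\<Sum>i<n. \<alpha> i)) * sprod g n a) *
         (r ^ (expo_deg b + \<alpha> n) * g n b))"
    unfolding sprod.simps conv_def sum_distrib_left
    by (rule sum.cong) (auto simp: splits_def expo_deg_add power_add mult_ac)
  also have "\<dots> = (\<Sum>(a, b)\<in>splits m. (r ^ (\<Sum>i<n. \<beta> i) * sprod f n a) * (r ^ \<beta> n * f n b))"
    using Suc by (intro sum.cong) auto
  also have "\<dots> = r ^ (\<Sum>i<Suc n. \<beta> i) * sprod f (Suc n) m"
    unfolding sprod.simps conv_def sum_distrib_left
    by (rule sum.cong) (auto simp: power_add mult_ac)
  finally show ?case .
qed

lemma tendsto_sprod:
  assumes "\<And>i m. i < n \<Longrightarrow> ((\<lambda>t. f t i m) \<longlongrightarrow> g i m) net"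
  shows "((\<lambda>t. sprod (f t) n m) \<longlongrightarrow> sprod g n m) net"
  using assms
  by (induction n arbitrary: m)
    (auto simp: conv_def case_prod_unfold intro!: tendsto_sum tendsto_mult)

text \<open>A permutation preserves the sum of the column indices, so all Leibniz terms of a
  determinant get the same total degree.\<close>

lemma sum_permutes_lessThan:
  assumes "p permutes {0..<n :: nat}"
  shows "(\<Sum>i<n. u i + p i) = (\<Sum>i<n. u i) + (\<Sum>i<n. i)"
  using sum.permute[OF assms, of id] by (simp add: sum.distrib lessThan_atLeast0)

lemma permutes_lessD: "p permutes {0..<n} \<Longrightarrow> i < n \<Longrightarrow> p i < (n :: nat)"
  using permutes_in_image[of p "{0..<n}" i] by simp

lemma sprod_permutes_Sym_le:
  assumes A: "\<And>i k. i < n \<Longrightarrow> k < n \<Longrightarrow> A i k \<in> Sym_le (D i + k)" and p: "p permutes {0..<n}"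
  shows "sprod (\<lambda>i. A i (p i)) n \<in> Sym_le ((\<Sum>i<n. D i) + (\<Sum>i<n. i))"
  using sprod_Sym_le[of n "\<lambda>i. A i (p i)" "\<lambda>i. D i + p i"] A permutes_lessD[OF p]
  unfolding sum_permutes_lessThan[OF p] by simp

text \<open>A coarse degree that ignores the row shift. It places \<open>sdet n A\<close> in some
  \<open>Sym_le\<close>, which gives its symmetry and its restriction to N variables.\<close>

lemma sdet_Sym_le_rough:
  assumes "\<And>i k. i < n \<Longrightarrow> k < n \<Longrightarrow> A i k \<in> Sym_le (D i + k)"
  shows "sdet n A \<in> Sym_le ((\<Sum>i<n. D i) + (\<Sum>i<n. i))"
  unfolding sdet_def
  by (intro Sym_le_sum Sym_le_cmult sprod_permutes_Sym_le assms) auto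

text \<open>In each Leibniz term the row shifts \<open>- i\<close> cancel against the column shifts
  \<open>p i\<close>, and the sum of the \<open>u i\<close> remains.\<close>

lemma sdet_Sym_le:
  assumes A: "\<And>i k. i < n \<Longrightarrow> k < n \<Longrightarrow> A i k \<in> Sym_le (D i + k)"
    and deg: "\<And>i k m. i < n \<Longrightarrow> k < n \<Longrightarrow> A i k m \<noteq> 0 \<Longrightarrow> expo_deg m + i \<le> u i + k"
  shows "sdet n A \<in> Sym_le (\<Sum>i<n. u i)"
proof (rule Sym_leI)
  fix m assume "sdet n A m \<noteq> 0"
  then obtain p where p: "p permutes {0..<n}" "sprod (\<lambda>i. A i (p i)) n m \<noteq> 0"
    unfolding sdet_def by (auto elim: sum.not_neutral_contains_not_neutral)
  have "expo_deg m + (\<Sum>i<n. i) \<le> (\<Sum>i<n. u i + p i)"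
    by (rule sprod_degree_le[OF _ p(2)]) (use deg permutes_lessD[OF p(1)] in auto)
  then show "expo_deg m \<le> (\<Sum>i<n. u i)"
    unfolding sum_permutes_lessThan[OF p(1)] by simp
next
  have S: "sdet n A \<in> Sym_le ((\<Sum>i<n. D i) + (\<Sum>i<n. i))"
    by (rule sdet_Sym_le_rough) (rule A)
  fix k m and \<pi> :: "nat \<Rightarrow> nat"
  assume "\<pi> permutes {..<k}"
  then show "sdet n A (Poly_Mapping.map_key \<pi> m) = sdet n A m"
    by (rule Sym_leD(2)[OF S])
qed

text \<open>The same cancellation for scaling; the power of r coming from the row shifts is divided
  out, where \<open>r \<noteq> 0\<close> enters.\<close>

lemma sdet_scale:
  fixes r :: complex
  assumes "r \<noteq> 0"
    and AB: "\<And>i k m. i < n \<Longrightarrow> k < n \<Longrightarrow> r ^ (expo_deg m + i) * B i k m = r ^ (u i + k) * A i k m"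
  shows "r ^ expo_deg m * sdet n B m = r ^ (\<Sum>i<n. u i) * sdet n A m"
proof -
  have *: "r ^ expo_deg m * sprod (\<lambda>i. B i (p i)) n m =
      r ^ (\<Sum>i<n. u i) * sprod (\<lambda>i. A i (p i)) n m" if p: "p permutes {0..<n}" for p
  proof -
    have "r ^ (expo_deg m + (\<Sum>i<n. i)) * sprod (\<lambda>i. B i (p i)) n m =
        r ^ (\<Sum>i<n. u i + p i) * sprod (\<lambda>i. A i (p i)) n m"
      by (rule sprod_scale) (use AB permutes_lessD[OF p] in auto)
    then show ?thesis
      unfolding sum_permutes_lessThan[OF p] power_add using \<open>r \<noteq> 0\<close> by simp
  qed
  have "r ^ expo_deg m * sdet n B m =
      (\<Sum>p | p permutes {0..<n}. of_int (sign p) * (r ^ expo_deg m * sprod (\<lambda>i. B i (p i)) n m))"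
    unfolding sdet_def sum_distrib_left by (simp add: mult_ac)
  also have "\<dots> = (\<Sum>p | p permutes {0..<n}.
      of_int (sign p) * (r ^ (\<Sum>i<n. u i) * sprod (\<lambda>i. A i (p i)) n m))"
    by (rule sum.cong) (auto simp: *)
  also have "\<dots> = r ^ (\<Sum>i<n. u i) * sdet n A m"
    unfolding sdet_def sum_distrib_left by (simp add: mult_ac)
  finally show ?thesis .
qed

lemma tendsto_sdet:
  assumes "\<And>i k m. i < n \<Longrightarrow> k < n \<Longrightarrow> ((\<lambda>t. A t i k m) \<longlongrightarrow> B i k m) net"
  shows "((\<lambda>t. sdet n (A t) m) \<longlongrightarrow> sdet n B m) net"
  unfolding sdet_def
  by (intro tendsto_sum tendsto_mult tendsto_const tendsto_sprod assms) (auto dest: permutes_lessD)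

text \<open>\<open>restrict_vars N\<close> turns \<open>conv\<close> into multiplication and is
  linear on coefficients, so it commutes with the Leibniz formula.\<close>

lemma det_restrict_vars:
  assumes A: "\<And>i k. i < n \<Longrightarrow> k < n \<Longrightarrow> A i k \<in> Sym_le (D i + k)"
  shows "Determinant.det (mat n n (\<lambda>(i, k). restrict_vars N (A i k))) = restrict_vars N (sdet n A)"
proof (rule poly_mapping_eqI)
  fix m
  have eq: "(\<Prod>i = 0..<n. mat n n (\<lambda>(i, k). restrict_vars N (A i k)) $$ (i, p i)) =
      restrict_vars N (sprod (\<lambda>i. A i (p i)) n)" if p: "p permutes {0..<n}" for p
    using restrict_vars_sprod[of n "\<lambda>i. A i (p i)" "\<lambda>i. D i + p i" N] A permutes_lessD[OF p]
    by (simp add: lessThan_atLeast0)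
  have "Poly_Mapping.lookup (Determinant.det (mat n n (\<lambda>(i, k). restrict_vars N (A i k)))) m =
      (\<Sum>p | p permutes {0..<n}. Poly_Mapping.lookup (Const (of_int (sign p)) * restrict_vars N (sprod (\<lambda>i. A i (p i)) n)) m)"
    unfolding det_def'[OF mat_carrier] lookup_sum Const_of_int
    by (rule sum.cong) (auto simp only: eq mem_Collect_eq)
  also have "\<dots> = (\<Sum>p | p permutes {0..<n}. of_int (sign p) *
      (if Poly_Mapping.keys m \<subseteq> {..<N} then sprod (\<lambda>i. A i (p i)) n m else 0))"
    unfolding lookup_Const_mult
    using lookup_restrict_vars[OF sprod_permutes_Sym_le[of n A D]] A by (intro sum.cong) auto
  also have "\<dots> = Poly_Mapping.lookup (restrict_vars N (sdet n A)) m"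
    using lookup_restrict_vars[OF sdet_Sym_le_rough[of n A D]] A by (simp add: sdet_def)
  finally show "Poly_Mapping.lookup (Determinant.det (mat n n (\<lambda>(i, k). restrict_vars N (A i k)))) m =
      Poly_Mapping.lookup (restrict_vars N (sdet n A)) m" .
qed

section \<open>Jacobi-Trudi formula for interpolation Schur polynomials\<close>

text \<open>By monotonicity all parts after the first zero vanish, so the support is an initial
  segment.\<close>

lemma is_partition_support:
  assumes "is_partition mu"
  shows "{i. mu i \<noteq> 0} = {..<plength mu}"
proof -
  define n where "n = (LEAST i. mu i = 0)"
  have "finite {i. mu i \<noteq> 0}"
    using assms by (simp add: is_partition_def)
  then have "\<exists>i. mu i = 0"
    using infinite_UNIV_nat by (metis (mono_tags, lifting) UNIV_eq_I mem_Collect_eq)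
  then have n0: "mu n = 0"
    unfolding n_def by (rule LeastI_ex)
  have "{i. mu i \<noteq> 0} = {..<n}"
  proof (rule Set.set_eqI)
    fix i
    show "i \<in> {i. mu i \<noteq> 0} \<longleftrightarrow> i \<in> {..<n}"
      using n0 assms not_less_Least[of i "\<lambda>i. mu i = 0"]
      unfolding is_partition_def antimono_def n_def[symmetric]
      by (cases "i < n") (auto dest: spec[of _ n])
  qed
  then show ?thesis
    by (simp add: plength_def)
qed

lemma is_partition_zero_beyond:
  assumes "is_partition mu" "plength mu \<le> i"
  shows "mu i = 0"
  using is_partition_support[OF assms(1)] assms(2) by (metis (mono_tags) lessThan_iff linorder_not_le mem_Collect_eq)

lemma psize_eq_sum:
  assumes "is_partition mu"
  shows "psize mu = (\<Sum>i<plength mu. mu i)"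
  using is_partition_support[OF assms] by (simp add: psize_def)

text \<open>The complete homogeneous symmetric function of degree k.\<close>

definition hsym :: "nat \<Rightarrow> symfun" where
  "hsym k m = of_bool (expo_deg m = k)"

lemma hsym_Sym_le: "hsym k \<in> Sym_le k"
  by (rule Sym_leI) (auto simp: hsym_def expo_deg_map_key permutes_bij split: if_splits)

definition hgf :: "nat \<Rightarrow> cpoly fps" where
  "hgf N = Abs_fps (\<lambda>k. restrict_vars N (hsym k))"

lemma lookup_hgf:
  "Poly_Mapping.lookup (fps_nth (hgf N) k) m = of_bool (Poly_Mapping.keys m \<subseteq> {..<N} \<and> expo_deg m = k)"
  by (simp add: hgf_def lookup_restrict_vars[OF hsym_Sym_le] hsym_def)

lemma expo_deg_eq_0_iff: "expo_deg m = 0 \<longleftrightarrow> m = 0"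
  by (auto simp: expo_deg_def in_keys_iff intro!: poly_mapping_eqI)

lemma expo_deg_single: "expo_deg (Poly_Mapping.single i n) = n"
  by (simp add: expo_deg_def)

lemma lookup_Var_mult:
  "Poly_Mapping.lookup (Var i * p) (Poly_Mapping.single i 1 + m) = Poly_Mapping.lookup p m"
proof -
  let ?e = "Poly_Mapping.single i 1 :: expo"
  have "Poly_Mapping.lookup (Var i * p) (?e + m) =
      (\<Sum>s\<in>splits (?e + m). if s = (?e, m) then Poly_Mapping.lookup p m else 0)"
    unfolding lookup_mult_splits Var_def
    by (rule sum.cong) (auto simp: splits_def lookup_single when_def split: if_splits)
  also have "\<dots> = Poly_Mapping.lookup p m"
    by (subst sum.delta[OF finite_splits]) (auto simp: splits_def)
  finally show ?thesis .
qed

lemma lookup_Var_mult_eq_0: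
  assumes "i \<notin> Poly_Mapping.keys m"
  shows "Poly_Mapping.lookup (Var i * p) m = 0"
  unfolding lookup_mult_splits Var_def using assms
  by (intro sum.neutral) (auto simp: splits_def lookup_single when_def keys_add_expo)

lemma expo_decompose:
  fixes m :: expo
  assumes "i \<in> Poly_Mapping.keys m"
  shows "Poly_Mapping.single i 1 + (m - Poly_Mapping.single i 1) = m"
  using assms
  by (intro poly_mapping_eqI) (auto simp: lookup_add lookup_minus lookup_single when_def in_keys_iff)

text \<open>Subtracting \<open>x_N h_(k-1)\<close> from \<open>h_k\<close> removes exactly the
  monomials divisible by the last variable; hence the split on whether N is a key of m.\<close>

lemma hgf_Suc: "hgf (Suc N) * (1 - fps_const (Var N) * fps_X) = hgf N"
proof (rule fps_ext, rule poly_mapping_eqI)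
  fix k and m :: expo
  let ?e = "Poly_Mapping.single N 1 :: expo"
  have sub: "Poly_Mapping.keys m' \<subseteq> {..<Suc N} \<and> N \<notin> Poly_Mapping.keys m' \<longleftrightarrow> Poly_Mapping.keys m' \<subseteq> {..<N}"
    for m' :: expo
    by (auto simp: less_Suc_eq)
  show "Poly_Mapping.lookup (fps_nth (hgf (Suc N) * (1 - fps_const (Var N) * fps_X)) k) m =
      Poly_Mapping.lookup (fps_nth (hgf N) k) m"
  proof (cases k)
    case 0
    then show ?thesis
      by (auto simp: fps_nth_mult_linear lookup_hgf expo_deg_eq_0_iff simp del: fps_mult_nth_0)
  next
    case (Suc k')
    have *: "Poly_Mapping.lookup (fps_nth (hgf (Suc N) * (1 - fps_const (Var N) * fps_X)) k) m =
        of_bool (Poly_Mapping.keys m \<subseteq> {..<Suc N} \<and> expo_deg m = k) -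
        Poly_Mapping.lookup (Var N * fps_nth (hgf (Suc N)) k') m"
      unfolding Suc fps_nth_mult_linear lookup_minus lookup_hgf ..
    show ?thesis
    proof (cases "N \<in> Poly_Mapping.keys m")
      case True
      define m' where "m' = m - ?e"
      have m: "m = ?e + m'"
        unfolding m'_def using expo_decompose[OF True] by simp
      show ?thesis
        unfolding * unfolding m lookup_Var_mult lookup_hgf Suc
        by (auto simp: keys_add_expo expo_deg_add expo_deg_single)
    next
      case False
      then show ?thesis
        unfolding * lookup_Var_mult_eq_0[OF False] lookup_hgf using sub[of m] by auto
    qed
  qed
qed

text \<open>The identity \<open>H(X) E(-X) = 1\<close>; it lets \<open>hgf N\<close> serve as the
  series G of the factorisation.\<close>

lemma hgf_efps: "hgf N * efps Var N = 1"
proof (induction N)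
  case 0
  have "hgf 0 = 1"
  proof (rule fps_ext, rule poly_mapping_eqI)
    fix k m
    show "Poly_Mapping.lookup (fps_nth (hgf 0) k) m = Poly_Mapping.lookup (fps_nth 1 k) m"
      by (cases k) (auto simp: lookup_hgf lookup_one when_def)
  qed
  then show ?case by simp
next
  case (Suc N)
  have "hgf (Suc N) * efps Var (Suc N) = hgf (Suc N) * (1 - fps_const (Var N) * fps_X) * efps Var N"
    by (simp add: efps_Suc mult_ac)
  then show ?case
    using Suc by (simp add: hgf_Suc)
qed

lemma efps_Const_nth: "fps_nth (efps (\<lambda>t. Const (c t)) n) k = Const (fps_nth (efps c n) k)"
proof (induction n arbitrary: k)
  case 0
  then show ?case by (simp add: Const_def)
next
  case (Suc n)
  then show ?case
    by (cases k) (simp_all add: efps_Suc fps_nth_mult_linear Const_diff Const_mult del: fps_mult_nth_0)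
qed

text \<open>The inhomogeneous function \<open>\<Sum>r\<le>w. e r * h_(w-r)\<close>: a monomial
  occurs only in the h of its own degree.\<close>

definition weighted_entry :: "(nat \<Rightarrow> complex) \<Rightarrow> nat \<Rightarrow> symfun" where
  "weighted_entry e w = (\<lambda>m. if expo_deg m \<le> w then e (w - expo_deg m) else 0)"

lemma weighted_entry_Sym_le: "weighted_entry e w \<in> Sym_le w"
  by (rule Sym_leI) (auto simp: weighted_entry_def expo_deg_map_key permutes_bij split: if_splits)

lemma efps_hgf_nth:
  "fps_nth (efps (\<lambda>t. Const (c t)) n * hgf N) w = restrict_vars N (weighted_entry (fps_nth (efps c n)) w)"
proof (rule poly_mapping_eqI)
  fix m
  have "Poly_Mapping.lookup (fps_nth (efps (\<lambda>t. Const (c t)) n * hgf N) w) m =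
      (\<Sum>i=0..w. fps_nth (efps c n) i * of_bool (Poly_Mapping.keys m \<subseteq> {..<N} \<and> expo_deg m = w - i))"
    by (simp add: fps_mult_nth lookup_sum efps_Const_nth lookup_Const_mult lookup_hgf)
  also have "\<dots> = (\<Sum>i=0..w. if i = w - expo_deg m then
      (if Poly_Mapping.keys m \<subseteq> {..<N} \<and> expo_deg m \<le> w then fps_nth (efps c n) (w - expo_deg m) else 0) else 0)"
    by (rule sum.cong) auto
  also have "\<dots> = Poly_Mapping.lookup (restrict_vars N (weighted_entry (fps_nth (efps c n)) w)) m"
    unfolding lookup_restrict_vars[OF weighted_entry_Sym_le] by (simp add: sum.delta weighted_entry_def)
  finally show "Poly_Mapping.lookup (fps_nth (efps (\<lambda>t. Const (c t)) n * hgf N) w) m =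
      Poly_Mapping.lookup (restrict_vars N (weighted_entry (fps_nth (efps c n)) w)) m" .
qed

text \<open>Each row has its own sequence \<open>e i\<close>, since the number
  \<open>mu i + (N - 1 - i)\<close> of nodes in use depends on the row.\<close>

definition jt_entry :: "(nat \<Rightarrow> nat) \<Rightarrow> (nat \<Rightarrow> nat \<Rightarrow> complex) \<Rightarrow> nat \<Rightarrow> nat \<Rightarrow> symfun" where
  "jt_entry mu e i k = (if i \<le> mu i + k then weighted_entry (e i) (mu i + k - i) else (\<lambda>m. 0))"

definition jacobi_trudi :: "(nat \<Rightarrow> nat) \<Rightarrow> (nat \<Rightarrow> nat \<Rightarrow> complex) \<Rightarrow> symfun" where
  "jacobi_trudi mu e = sdet (plength mu) (jt_entry mu e)"

lemma jt_entry_Sym_le: "jt_entry mu e i k \<in> Sym_le (mu i + k)"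
  unfolding jt_entry_def by (auto intro: Sym_le_zero Sym_le_mono[OF weighted_entry_Sym_le])

lemma jt_entry_nonzero: "jt_entry mu e i k m \<noteq> 0 \<Longrightarrow> expo_deg m + i \<le> mu i + k"
  by (auto simp: jt_entry_def weighted_entry_def split: if_splits)

lemma jacobi_trudi_Sym_le:
  assumes "is_partition mu"
  shows "jacobi_trudi mu e \<in> Sym_le (psize mu)"
  unfolding jacobi_trudi_def psize_eq_sum[OF assms]
  by (rule sdet_Sym_le) (auto intro: jt_entry_Sym_le dest: jt_entry_nonzero)

lemma restrict_vars_zero: "restrict_vars N (\<lambda>m. 0) = 0"
  by (rule poly_mapping_eqI) (simp add: lookup_restrict_vars[OF Sym_le_zero])

lemma vandermonde_nonzero: "vandermonde N \<noteq> 0"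
proof -
  have "Var i \<noteq> Var j" if "i < j" for i j
  proof
    assume "Var i = Var j"
    then have "Poly_Mapping.lookup (Var i) (Poly_Mapping.single i 1) =
        Poly_Mapping.lookup (Var j) (Poly_Mapping.single i 1)" by simp
    then have "Poly_Mapping.single j (1 :: nat) = Poly_Mapping.single i 1"
      by (auto simp: Var_def lookup_single when_def split: if_splits)
    then have "Poly_Mapping.lookup (Poly_Mapping.single j (1 :: nat)) i = Poly_Mapping.lookup (Poly_Mapping.single i 1) i"
      by simp
    then show False
      using that by (simp add: lookup_single when_def split: if_splits)
  qed
  then show ?thesis
    by (auto simp: vandermonde_def)
qed

text \<open>The alternant is \<open>coeff_mat\<close> times \<open>omit_mat\<close>, and the second
  factor has the Vandermonde product as determinant. The quotient is the determinant of the first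
  factor, which shrinks to size \<open>plength mu\<close>.\<close>

lemma interp_schur_eq_jacobi_trudi:
  assumes mu: "is_partition mu" and N: "plength mu \<le> N"
  shows "interp_schur mu N c = restrict_vars N (jacobi_trudi mu (\<lambda>i. fps_nth (efps c (mu i + (N - 1 - i)))))"
    (is "_ = restrict_vars N (jacobi_trudi mu ?e)")
proof -
  let ?A = "mat N N (\<lambda>(i, j). interp_power (Var j) c (mu i + (N - 1 - i)))"
  let ?l = "plength mu"
  let ?c = "\<lambda>t. Const (c t)"
  have G0: "fps_nth (hgf N) 0 = 1"
    using arg_cong[OF hgf_efps[of N], of "\<lambda>F. fps_nth F 0"] by (simp add: efps_nth_0)
  have "?A = coeff_mat (hgf N) (\<lambda>_. ?c) mu N * omit_mat Var N"
    unfolding interp_power_def alternant_factor[OF hgf_efps, symmetric] ..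
  then have "Determinant.det ?A =
      Determinant.det (coeff_mat (hgf N) (\<lambda>_. ?c) mu N) * Determinant.det (omit_mat Var N)"
    by (simp add: det_mult[of _ N] coeff_mat_def omit_mat_def)
  also have "Determinant.det (omit_mat Var N) = vandermonde N"
    by (simp add: det_omit_mat[OF hgf_efps] vandermonde_def)
  also have "Determinant.det (coeff_mat (hgf N) (\<lambda>_. ?c) mu N) =
      Determinant.det (mat ?l ?l (\<lambda>(i, k). if i \<le> mu i + k
        then fps_nth (efps ?c (mu i + (N - 1 - i)) * hgf N) (mu i + k - i) else 0))"
    using is_partition_zero_beyond[OF mu] by (intro det_coeff_mat G0 N) auto
  also have "mat ?l ?l (\<lambda>(i, k). if i \<le> mu i + k
        then fps_nth (efps ?c (mu i + (N - 1 - i)) * hgf N) (mu i + k - i) else 0) =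
      mat ?l ?l (\<lambda>(i, k). restrict_vars N (jt_entry mu ?e i k))"
    by (rule cong_mat) (auto simp: efps_hgf_nth jt_entry_def restrict_vars_zero)
  also have "Determinant.det \<dots> = restrict_vars N (jacobi_trudi mu ?e)"
    unfolding jacobi_trudi_def by (rule det_restrict_vars) (rule jt_entry_Sym_le)
  finally have det: "restrict_vars N (jacobi_trudi mu ?e) * vandermonde N = Determinant.det ?A" ..
  show ?thesis
    unfolding interp_schur_def det[symmetric]
    by (rule the_equality) (use vandermonde_nonzero in auto)
qed

section \<open>Coefficientwise convergence of symmetric functions\<close>

lemma tendsto_fun_iff:
  fixes f :: "'a \<Rightarrow> 'i \<Rightarrow> 'b::topological_space"
  shows "(f \<longlongrightarrow> l) F \<longleftrightarrow> (\<forall>i. ((\<lambda>x. f x i) \<longlongrightarrow> l i) F)"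
  using limitin_componentwise[of "\<lambda>_. euclidean :: 'b topology" UNIV f l F]
  by (simp add: euclidean_product_topology)

lemma limitin_Sym_le_top_iff:
  "limitin (Sym_le_top d) f F net \<longleftrightarrow>
     F \<in> Sym_le d \<and> (\<forall>\<^sub>F t in net. f t \<in> Sym_le d) \<and> (\<forall>m. ((\<lambda>t. f t m) \<longlongrightarrow> F m) net)"
  by (auto simp: limitin_subtopology tendsto_fun_iff)

text \<open>Vanishing above degree d and symmetry are equalities of coefficients, and these survive
  coefficientwise limits.\<close>

lemma Sym_le_limit:
  assumes "\<And>m. ((\<lambda>t. G t m) \<longlongrightarrow> F m) net" "\<And>t. G t \<in> Sym_le d" "net \<noteq> bot"
  shows "F \<in> Sym_le d"
proof (rule Sym_leI)
  fix m assume "F m \<noteq> 0"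
  show "expo_deg m \<le> d"
  proof (rule ccontr)
    assume "\<not> expo_deg m \<le> d"
    then have "(\<lambda>t. G t m) = (\<lambda>t. 0)"
      using Sym_leD(1)[OF assms(2)] by blast
    then have "((\<lambda>t. 0) \<longlongrightarrow> F m) net"
      using assms(1)[of m] by simp
    then show False
      using \<open>F m \<noteq> 0\<close> \<open>net \<noteq> bot\<close> by (simp add: tendsto_const_iff)
  qed
next
  fix n m and \<pi> :: "nat \<Rightarrow> nat"
  assume "\<pi> permutes {..<n}"
  then have "(\<lambda>t. G t (Poly_Mapping.map_key \<pi> m)) = (\<lambda>t. G t m)"
    using Sym_leD(2)[OF assms(2)] by blast
  then show "F (Poly_Mapping.map_key \<pi> m) = F m"
    using assms(1)[of "Poly_Mapping.map_key \<pi> m"] assms(1)[of m] \<open>net \<noteq> bot\<close>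
    by (auto intro: tendsto_unique)
qed

lemma restrict_vars_SymN_le:
  assumes "F \<in> Sym_le d"
  shows "restrict_vars N F \<in> SymN_le d N"
proof -
  have "Poly_Mapping.keys (Poly_Mapping.map_key \<pi> m) \<subseteq> {..<N} \<longleftrightarrow> Poly_Mapping.keys m \<subseteq> {..<N}"
    if "\<pi> permutes {..<N}" for \<pi> and m :: expo
  proof -
    have "\<pi> -` Poly_Mapping.keys m \<subseteq> {..<N} \<longleftrightarrow> Poly_Mapping.keys m \<subseteq> {..<N}"
      using permutes_in_image[OF that] permutes_inverses(1)[OF that]
      by (auto simp: subset_eq Ball_def) metis
    then show ?thesis
      by (simp add: keys_map_key permutes_inj[OF that])
  qed
  then show ?thesis
    unfolding SymN_le_def mem_Collect_eq lookup_restrict_vars[OF assms]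
    using Sym_leD[OF assms] by auto
qed

lemma eventually_keys_bounded:
  "\<forall>\<^sub>F N in sequentially. Poly_Mapping.keys (m :: expo) \<subseteq> {..<N}"
proof -
  obtain N where "Poly_Mapping.keys m \<subseteq> {..<N}"
    using expo_keys_bounded by blast
  then show ?thesis
    by (intro eventually_sequentiallyI[of N]) auto
qed

text \<open>\<open>sym_iota d N\<close> picks a preimage of \<open>f N\<close> under
  \<open>restrict_vars N\<close>. Its coefficient at m is that of \<open>G N\<close> once the first
  N variables include those of m.\<close>

lemma Sym_convergesI:
  assumes f: "\<forall>\<^sub>F N in sequentially. f N = restrict_vars N (G N)"
    and G: "\<And>N. G N \<in> Sym_le w" and lim: "\<And>m. (\<lambda>N. G N m) \<longlonglongrightarrow> F m"
  shows "Sym_converges f F"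
proof -
  have F: "F \<in> Sym_le w"
    by (rule Sym_le_limit[OF lim G]) simp
  have fS: "\<forall>\<^sub>F N in sequentially. f N \<in> SymN_le w N"
    using f by eventually_elim (auto intro: restrict_vars_SymN_le G)
  have "limitin (Sym_le_top d) (\<lambda>N. sym_iota d N (f N)) F sequentially" if d: "w \<le> d" for d
  proof -
    let ?H = "\<lambda>N. sym_iota d N (f N)"
    have H: "\<forall>\<^sub>F N in sequentially. ?H N \<in> Sym_le d \<and> restrict_vars N (?H N) = restrict_vars N (G N)"
      using f
    proof eventually_elim
      case (elim N)
      then have *: "f N \<in> restrict_vars N ` Sym_le d"
        using Sym_le_mono[OF G d] by auto
      show ?case
        using inv_into_into[OF *] f_inv_into_f[OF *] elim unfolding sym_iota_def by simp
    qed
    have "(\<lambda>N. ?H N m) \<longlonglongrightarrow> F m" for m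
    proof (rule Lim_transform_eventually[OF lim])
      show "\<forall>\<^sub>F N in sequentially. G N m = ?H N m"
        using H eventually_keys_bounded[of m]
      proof eventually_elim
        case (elim N)
        then have "Poly_Mapping.lookup (restrict_vars N (?H N)) m = Poly_Mapping.lookup (restrict_vars N (G N)) m"
          by simp
        then show ?case
          using elim lookup_restrict_vars[OF G, of N N m] lookup_restrict_vars[of "?H N" d N m] by simp
      qed
    qed
    then show ?thesis
      unfolding limitin_Sym_le_top_iff using H Sym_le_mono[OF F d]
      by (auto elim: eventually_mono)
  qed
  then show ?thesis
    unfolding Sym_converges_def Sym_def using F fS
    by (auto intro: eventually_sequentiallyI)
qed

lemma Sym_converges_unique:
  assumes "Sym_converges f F" "Sym_converges f F'"
  shows "F = F'"
proof -
  have "\<forall>\<^sub>F d in sequentially. limitin (Sym_le_top d) (\<lambda>N. sym_iota d N (f N)) F sequentially \<and>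
      limitin (Sym_le_top d) (\<lambda>N. sym_iota d N (f N)) F' sequentially"
    using assms unfolding Sym_converges_def by (auto intro: eventually_conj)
  then obtain d where
    "limitin (Sym_le_top d) (\<lambda>N. sym_iota d N (f N)) F sequentially"
    "limitin (Sym_le_top d) (\<lambda>N. sym_iota d N (f N)) F' sequentially"
    using eventually_happens'[OF sequentially_bot] by blast
  then have "F m = F' m" for m
    unfolding limitin_Sym_le_top_iff by (auto intro: LIMSEQ_unique)
  then show ?thesis by blast
qed

text \<open>Continuity in the node coefficients, used both for N tending to infinity and for a
  varying parameter \<sigma>.\<close>

lemma tendsto_jacobi_trudi:
  assumes "\<And>i k. i < plength mu \<Longrightarrow> ((\<lambda>t. e t i k) \<longlongrightarrow> e' i k) net"
  shows "((\<lambda>t. jacobi_trudi mu (e t) m) \<longlongrightarrow> jacobi_trudi mu e' m) net"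
  unfolding jacobi_trudi_def
  by (rule tendsto_sdet) (use assms in \<open>auto simp: jt_entry_def weighted_entry_def\<close>)

text \<open>If the coefficient of index k has weight k and each variable weight 1, then entry (i, j)
  is homogeneous of weight \<open>mu i + j - i\<close>, and \<open>sdet_scale\<close>
  applies.\<close>

lemma jacobi_trudi_scale:
  fixes r :: complex
  assumes mu: "is_partition mu" and "r \<noteq> 0"
    and e: "\<And>i k. i < plength mu \<Longrightarrow> e' i k = r ^ k * e i k"
  shows "r ^ psize mu * jacobi_trudi mu e m = r ^ expo_deg m * jacobi_trudi mu e' m"
  unfolding jacobi_trudi_def psize_eq_sum[OF mu]
proof (rule sdet_scale[OF \<open>r \<noteq> 0\<close>, symmetric])
  fix i k m
  assume "i < plength mu"
  then show "r ^ (expo_deg m + i) * jt_entry mu e' i k m = r ^ (mu i + k) * jt_entry mu e i k m"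
    by (auto simp: jt_entry_def weighted_entry_def e simp flip: power_add mult.assoc)
qed

lemma interp_limit_unique:
  assumes mu: "is_partition mu"
    and lim: "\<And>i k. i < plength mu \<Longrightarrow>
      (\<lambda>N. fps_nth (efps (c N) (mu i + (N - 1 - i))) k) \<longlonglongrightarrow> e i k"
  shows "(THE F. Sym_converges (\<lambda>N. interp_schur mu N (c N)) F) = jacobi_trudi mu e"
proof (rule the_equality)
  show conv: "Sym_converges (\<lambda>N. interp_schur mu N (c N)) (jacobi_trudi mu e)"
  proof (rule Sym_convergesI)
    show "\<forall>\<^sub>F N in sequentially. interp_schur mu N (c N) =
        restrict_vars N (jacobi_trudi mu (\<lambda>i. fps_nth (efps (c N) (mu i + (N - 1 - i)))))"
      using eventually_ge_at_top[of "plength mu"]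
      by eventually_elim (rule interp_schur_eq_jacobi_trudi[OF mu])
    show "(\<lambda>N. jacobi_trudi mu (\<lambda>i. fps_nth (efps (c N) (mu i + (N - 1 - i)))) m) \<longlonglongrightarrow>
        jacobi_trudi mu e m" for m
      by (rule tendsto_jacobi_trudi) (rule lim)
  qed (rule jacobi_trudi_Sym_le[OF mu])
  show "F = jacobi_trudi mu e" if "Sym_converges (\<lambda>N. interp_schur mu N (c N)) F" for F
    using that conv by (rule Sym_converges_unique)
qed

section \<open>Stable limits of the interpolation polynomials\<close>

text \<open>Newton's recursion from power sums p to signed elementary polynomials. It reads only p
  at 1, 2, and so on; the power sum with exponent 0 counts the nodes and would diverge with
  N.\<close>

fun newton :: "(nat \<Rightarrow> complex) \<Rightarrow> nat \<Rightarrow> complex" where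
  "newton p 0 = 1"
| "newton p (Suc k) = - (\<Sum>j\<le>k. newton p j * p (Suc k - j)) / of_nat (Suc k)"

declare newton.simps(2) [simp del]

lemma tendsto_newton:
  assumes "\<And>j. ((\<lambda>t. p t (Suc j)) \<longlongrightarrow> p' (Suc j)) net"
  shows "((\<lambda>t. newton (p t) k) \<longlongrightarrow> newton p' k) net"
proof (induction k rule: less_induct)
  case (less k)
  show ?case
  proof (cases k)
    case (Suc k')
    have "((\<lambda>t. newton (p t) j * p t (Suc k' - j)) \<longlongrightarrow> newton p' j * p' (Suc k' - j)) net" if "j \<le> k'" for j
      using that less.IH[of j] assms[of "k' - j"] by (intro tendsto_mult) (auto simp: Suc Suc_diff_le)
    then show ?thesis
      unfolding Suc newton.simps
      by (intro tendsto_divide tendsto_minus tendsto_sum tendsto_const) (auto simp del: of_nat_Suc)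
  qed simp
qed

lemma newton_scale:
  assumes "\<And>j. p' (Suc j) = r ^ Suc j * p (Suc j)"
  shows "newton p' k = r ^ k * newton p k"
proof (induction k rule: less_induct)
  case (less k)
  show ?case
  proof (cases k)
    case (Suc k')
    have "newton p' j * p' (Suc k' - j) = r ^ k * (newton p j * p (Suc k' - j))" if "j \<le> k'" for j
    proof -
      have "newton p' j * p' (Suc i) = r ^ (j + Suc i) * (newton p j * p (Suc i))" for i
        using that less.IH[of j] assms[of i] by (simp add: Suc power_add mult_ac)
      moreover have "r ^ k = r ^ (j + Suc (k' - j))"
        using that Suc by simp
      ultimately show ?thesis
        using that by (simp only: Suc_diff_le)
    qed
    then show ?thesis
      unfolding Suc newton.simps by (simp add: sum_distrib_left flip: Suc)
  qed simp
qed

text \<open>Newton's identities, from the logarithmic derivative of \<open>\<Prod>t. 1 - c t X\<close>.\<close>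

lemma efps_deriv:
  fixes c :: "nat \<Rightarrow> complex"
  shows "fps_deriv (efps c n) = - efps c n * Abs_fps (\<lambda>j. \<Sum>t<n. c t ^ Suc j)"
proof (induction n)
  case 0
  have "Abs_fps (\<lambda>j. 0) = (0 :: complex fps)"
    by (rule fps_ext) simp
  then show ?case by simp
next
  case (Suc n)
  let ?P = "\<lambda>n. Abs_fps (\<lambda>j. \<Sum>t<n. c t ^ Suc j)"
  let ?\<Gamma> = "Abs_fps (\<lambda>p. c n ^ p)"
  let ?L = "1 - fps_const (c n) * fps_X"
  have P: "?P (Suc n) = ?P n + fps_const (c n) * ?\<Gamma>"
    by (rule fps_ext) simp
  have D: "fps_deriv ?L = - fps_const (c n)"
    by simp
  have G: "?L * ?\<Gamma> = 1"
    using geometric_fps_mult[of "c n"] by (simp add: mult.commute)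
  have alg: "- E * (f * (L * G)) - E * P * L = - (E * L) * (P + f * G)" for E f L G P :: "complex fps"
    by (simp add: algebra_simps)
  have "fps_deriv (efps c (Suc n)) = efps c n * (- fps_const (c n)) + (- efps c n * ?P n) * ?L"
    unfolding efps_Suc fps_deriv_mult D Suc by (simp only: add.commute)
  \<comment> \<open>Inserting \<open>?L * ?\<Gamma> = 1\<close> into the first summand produces the
    common factor \<open>efps c n * ?L\<close>.\<close>
  also have "\<dots> = - efps c n * (fps_const (c n) * (?L * ?\<Gamma>)) - efps c n * ?P n * ?L"
    unfolding G by (simp flip: fps_const_neg)
  also have "\<dots> = - (efps c n * ?L) * (?P n + fps_const (c n) * ?\<Gamma>)"
    by (rule alg)
  finally show ?case
    unfolding P efps_Suc .
qed

text \<open>Comparing coefficients in \<open>efps_deriv\<close> yields the recursion of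
  \<open>newton\<close>.\<close>

lemma efps_nth_newton:
  fixes c :: "nat \<Rightarrow> complex"
  shows "fps_nth (efps c n) k = newton (\<lambda>j. \<Sum>t<n. c t ^ j) k"
proof (induction k rule: less_induct)
  case (less k)
  show ?case
  proof (cases k)
    case 0
    then show ?thesis by (simp add: efps_nth_0)
  next
    case (Suc k')
    have "of_nat (Suc k') * fps_nth (efps c n) (Suc k') = fps_nth (fps_deriv (efps c n)) k'"
      by simp
    also have "\<dots> = - (\<Sum>j\<le>k'. fps_nth (efps c n) j * (\<Sum>t<n. c t ^ Suc (k' - j)))"
      unfolding efps_deriv by (simp add: fps_mult_nth atLeast0AtMost flip: sum_negf)
    also have "(\<Sum>j\<le>k'. fps_nth (efps c n) j * (\<Sum>t<n. c t ^ Suc (k' - j))) =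
        (\<Sum>j\<le>k'. newton (\<lambda>j. \<Sum>t<n. c t ^ j) j * (\<Sum>t<n. c t ^ (Suc k' - j)))"
      by (rule sum.cong) (auto simp: less Suc Suc_diff_le)
    finally show ?thesis
      unfolding Suc newton.simps by (simp add: field_simps del: of_nat_Suc)
  qed
qed

text \<open>The second exponent is an integer because a row may use more than N nodes, which makes
  it negative.\<close>

definition node :: "real \<Rightarrow> complex \<Rightarrow> complex \<Rightarrow> nat \<Rightarrow> nat \<Rightarrow> complex" where
  "node q \<sigma> \<tau> N t = \<sigma> * of_real (q ^ t) + \<tau> * of_real (q powi (int N - 1 - int t))"

text \<open>For \<open>j > 0\<close>, the limit of the j-th power sum of the first N + r nodes. Only
  the two pure powers of the binomial expansion survive; the \<tau> part is a geometric series read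
  backwards from its smallest exponent \<open>- r\<close>.\<close>

definition node_power_sum :: "real \<Rightarrow> int \<Rightarrow> complex \<Rightarrow> complex \<Rightarrow> nat \<Rightarrow> complex" where
  "node_power_sum q r \<sigma> \<tau> j =
     (\<sigma> ^ j + \<tau> ^ j * of_real (q powi (- r * int j))) / of_real (1 - q ^ j)"

context
  fixes q :: real
  assumes q: "0 < q" "q < 1"
begin

lemma tendsto_geometric_power:
  assumes "0 < j"
  shows "(\<lambda>n. \<Sum>t<n. (q ^ j) ^ t) \<longlonglongrightarrow> 1 / (1 - q ^ j)"
  using geometric_sums[of "q ^ j"] q assms unfolding sums_def
  by (simp add: power_less_one_iff)

text \<open>The sum is geometric for \<open>a = j\<close> and geometric in reverse order for
  \<open>a = 0\<close>. In between, each of the N + r terms is \<open>O(q^N)\<close>, so the sum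
  tends to 0.\<close>

lemma tendsto_mixed_sum:
  fixes r :: int and n :: "nat \<Rightarrow> nat"
  assumes n: "\<forall>\<^sub>F N in sequentially. int (n N) = int N + r" and a: "a \<le> j" "0 < j"
  shows "(\<lambda>N. \<Sum>t<n N. q ^ (t * a) * (q powi (int N - 1 - int t)) ^ (j - a)) \<longlonglongrightarrow>
    (if a = j then 1 / (1 - q ^ j) else if a = 0 then q powi (- r * int j) / (1 - q ^ j) else 0)"
proof -
  have n_top: "filterlim n at_top sequentially"
  proof (rule filterlim_at_top_mono[where f = "\<lambda>N. N - nat \<bar>r\<bar>"])
    show "filterlim (\<lambda>N. N - nat \<bar>r\<bar>) at_top sequentially"
      by (rule filterlim_minus_const_nat_at_top)
    show "\<forall>\<^sub>F N in sequentially. N - nat \<bar>r\<bar> \<le> n N"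
      using n by eventually_elim linarith
  qed
  have geo: "(\<lambda>N. \<Sum>t<n N. (q ^ j) ^ t) \<longlonglongrightarrow> 1 / (1 - q ^ j)"
    using tendsto_geometric_power[OF a(2)] n_top by (rule filterlim_compose)
  consider "a = j" | "a = 0" "a \<noteq> j" | "0 < a" "a < j"
    using a by linarith
  then show ?thesis
  proof cases
    case 1
    have "(q ^ j) ^ t = q ^ (t * j)" for t
      by (metis mult.commute power_mult)
    then show ?thesis
      using 1 geo by simp
  next
    case 2
    have "\<forall>\<^sub>F N in sequentially. q powi (- r * int j) * (\<Sum>t<n N. (q ^ j) ^ t) =
        (\<Sum>t<n N. q ^ (t * a) * (q powi (int N - 1 - int t)) ^ (j - a))"
      using n
    proof eventually_elim
      case (elim N)
      \<comment> \<open>At the last index \<open>n N - 1\<close> the exponent of the node is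
        \<open>- r\<close>; read from there, the sum is geometric.\<close>
      have "q powi (- r * int j) * (\<Sum>t<n N. (q ^ j) ^ t) =
          (\<Sum>t<n N. q powi (- r * int j) * (q ^ j) ^ (n N - 1 - t))"
        unfolding sum_distrib_left
        by (rule sum.reindex_bij_witness[of _ "\<lambda>t. n N - 1 - t" "\<lambda>t. n N - 1 - t"]) auto
      also have "\<dots> = (\<Sum>t<n N. (q powi (int N - 1 - int t)) ^ j)"
      proof (rule sum.cong)
        fix t assume "t \<in> {..<n N}"
        then have "int (n N - 1 - t) = int N - 1 - int t + r"
          using elim by auto
        then have "(q ^ j) ^ (n N - 1 - t) = q powi ((int N - 1 - int t + r) * int j)"
          by (metis mult.commute of_nat_mult power_int_of_nat power_mult)
        then show "q powi (- r * int j) * (q ^ j) ^ (n N - 1 - t) = (q powi (int N - 1 - int t)) ^ j"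
          using q by (simp add: algebra_simps flip: power_int_add power_int_mult power_int_of_nat)
      qed simp
      finally show ?case
        using 2 by simp
    qed
    moreover have "(\<lambda>N. q powi (- r * int j) * (\<Sum>t<n N. (q ^ j) ^ t)) \<longlonglongrightarrow>
        q powi (- r * int j) * (1 / (1 - q ^ j))"
      by (intro tendsto_intros geo)
    ultimately show ?thesis
      using 2 by (auto intro: Lim_transform_eventually)
  next
    case 3
    \<comment> \<open>\<open>C * q ^ N\<close> is q to the power
      \<open>N - 1 - \<bar>r\<bar> * j\<close>, a lower bound for the exponents of the mixed
      terms.\<close>
    define C where "C = q powi (- 1 - \<bar>r\<bar> * int j)"
    have "(\<lambda>N. \<Sum>t<n N. q ^ (t * a) * (q powi (int N - 1 - int t)) ^ (j - a)) \<longlonglongrightarrow> 0"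
    proof (rule tendsto_sandwich[OF _ _ tendsto_const])
      show "\<forall>\<^sub>F N in sequentially. 0 \<le> (\<Sum>t<n N. q ^ (t * a) * (q powi (int N - 1 - int t)) ^ (j - a))"
        using q by (auto intro!: always_eventually sum_nonneg)
      show "\<forall>\<^sub>F N in sequentially. (\<Sum>t<n N. q ^ (t * a) * (q powi (int N - 1 - int t)) ^ (j - a)) \<le>
          (real N + real_of_int \<bar>r\<bar>) * (C * q ^ N)"
        using n
      proof eventually_elim
        case (elim N)
        have "(\<Sum>t<n N. q ^ (t * a) * (q powi (int N - 1 - int t)) ^ (j - a)) \<le> (\<Sum>t<n N. C * q ^ N)"
        proof (rule sum_mono)
          fix t assume t: "t \<in> {..<n N}"
          define s where "s = int N - 1 - int t"
          have s: "- \<bar>r\<bar> \<le> s"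
            using t elim by (auto simp: s_def)
          \<comment> \<open>As s can be as low as \<open>- \<bar>r\<bar>\<close>, the factor
            \<open>j - a\<close> may decrease it, by at most
            \<open>(j - a - 1) * \<bar>r\<bar>\<close>. Since s and t add up to N - 1, the bound on
            the exponent follows.\<close>
          have "int (j - a) * s \<ge> s - \<bar>r\<bar> * int j"
          proof -
            define u where "u = int (j - a - 1)"
            have u: "int (j - a) = u + 1" "0 \<le> u" "u \<le> int j"
              using 3 by (auto simp: u_def)
            have "0 \<le> u * (s + \<bar>r\<bar>)"
              using s u by (intro mult_nonneg_nonneg) auto
            moreover have "u * \<bar>r\<bar> \<le> int j * \<bar>r\<bar>"
              using u by (intro mult_right_mono) auto
            ultimately show ?thesis
              unfolding u(1) by (simp add: algebra_simps)
          qed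
          moreover have "int t \<le> int t * int a"
            using 3 by (simp add: mult_le_cancel_left1)
          ultimately have le: "int N - 1 - \<bar>r\<bar> * int j \<le> int t * int a + s * int (j - a)"
            by (simp add: s_def mult.commute)
          have "q ^ (t * a) * (q powi s) ^ (j - a) = q powi (int t * int a + s * int (j - a))"
            using q by (simp add: power_int_add power_int_mult flip: power_int_of_nat)
          also have "\<dots> \<le> q powi (int N - 1 - \<bar>r\<bar> * int j)"
            using le q by (intro power_int_decreasing) auto
          also have "\<dots> = q powi (- 1 - \<bar>r\<bar> * int j + int N)"
            by (simp add: algebra_simps)
          also have "\<dots> = C * q ^ N"
            using q by (simp add: C_def power_int_add)
          finally show "q ^ (t * a) * (q powi (int N - 1 - int t)) ^ (j - a) \<le> C * q ^ N"
            by (simp add: s_def)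
        qed
        also have "\<dots> = real (n N) * (C * q ^ N)"
          by simp
        also have "\<dots> \<le> (real N + real_of_int \<bar>r\<bar>) * (C * q ^ N)"
        proof (rule mult_right_mono)
          have "real_of_int (int (n N)) = real_of_int (int N + r)"
            by (simp only: elim)
          then show "real (n N) \<le> real N + real_of_int \<bar>r\<bar>"
            by simp
        qed (use q in \<open>simp add: C_def\<close>)
        finally show ?case .
      qed
      have "(\<lambda>N. C * (real N * q ^ N) + (real_of_int \<bar>r\<bar> * C) * q ^ N) \<longlonglongrightarrow> C * 0 + (real_of_int \<bar>r\<bar> * C) * 0"
        using q by (intro tendsto_intros powser_times_n_limit_0 LIMSEQ_power_zero) auto
      then show "(\<lambda>N. (real N + real_of_int \<bar>r\<bar>) * (C * q ^ N)) \<longlonglongrightarrow> 0"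
        by (simp add: algebra_simps)
    qed
    then show ?thesis
      using 3 by simp
  qed
qed

text \<open>Binomial expansion of the nodes, with \<open>tendsto_mixed_sum\<close> for each of its
  terms.\<close>

lemma tendsto_node_power_sum:
  fixes r :: int and n :: "nat \<Rightarrow> nat"
  assumes n: "\<forall>\<^sub>F N in sequentially. int (n N) = int N + r" and j: "0 < j"
  shows "(\<lambda>N. \<Sum>t<n N. node q \<sigma> \<tau> N t ^ j) \<longlonglongrightarrow> node_power_sum q r \<sigma> \<tau> j"
proof -
  define T where "T a N = (\<Sum>t<n N. q ^ (t * a) * (q powi (int N - 1 - int t)) ^ (j - a))" for a N
  define L where "L a = (if a = j then 1 / (1 - q ^ j) else if a = 0 then q powi (- r * int j) / (1 - q ^ j) else 0)" for a
  have "(\<Sum>t<n N. node q \<sigma> \<tau> N t ^ j) =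
      (\<Sum>a\<le>j. of_nat (j choose a) * \<sigma> ^ a * \<tau> ^ (j - a) * of_real (T a N))" for N
  proof -
    have "(\<Sum>t<n N. node q \<sigma> \<tau> N t ^ j) = (\<Sum>t<n N. \<Sum>a\<le>j. of_nat (j choose a) * \<sigma> ^ a * \<tau> ^ (j - a) *
        of_real (q ^ (t * a) * (q powi (int N - 1 - int t)) ^ (j - a)))"
      unfolding node_def binomial_ring
      by (intro sum.cong refl) (simp add: power_mult_distrib power_mult mult_ac)
    then show ?thesis
      unfolding T_def of_real_sum sum_distrib_left by (subst sum.swap) simp
  qed
  moreover have "(\<lambda>N. \<Sum>a\<le>j. of_nat (j choose a) * \<sigma> ^ a * \<tau> ^ (j - a) * of_real (T a N)) \<longlonglongrightarrow>
      (\<Sum>a\<le>j. of_nat (j choose a) * \<sigma> ^ a * \<tau> ^ (j - a) * of_real (L a))"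
    unfolding T_def L_def using n j by (intro tendsto_intros tendsto_mixed_sum) auto
  moreover have "(\<Sum>a\<le>j. of_nat (j choose a) * \<sigma> ^ a * \<tau> ^ (j - a) * complex_of_real (L a)) =
      (\<Sum>a\<in>{0, j}. of_nat (j choose a) * \<sigma> ^ a * \<tau> ^ (j - a) * complex_of_real (L a))"
    by (rule sum.mono_neutral_right) (auto simp: L_def)
  moreover have "\<dots> = node_power_sum q r \<sigma> \<tau> j"
    using j by (simp add: L_def node_power_sum_def add_divide_distrib)
  ultimately show ?thesis
    by simp
qed

text \<open>For N variables, row i uses N + r nodes with \<open>r = mu i - 1 - i\<close>, the shift
  passed to \<open>node_power_sum\<close>.\<close>

definition interp_limit :: "(nat \<Rightarrow> nat) \<Rightarrow> complex \<Rightarrow> complex \<Rightarrow> symfun" where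
  "interp_limit mu \<sigma> \<tau> =
     jacobi_trudi mu (\<lambda>i. newton (node_power_sum q (int (mu i) - 1 - int i) \<sigma> \<tau>))"

lemma interp_limit_eq:
  assumes mu: "is_partition mu"
  shows "(THE F. Sym_converges (\<lambda>N. interp_schur mu N (node q \<sigma> \<tau> N)) F) = interp_limit mu \<sigma> \<tau>"
  unfolding interp_limit_def
proof (rule interp_limit_unique[OF mu])
  fix i k
  have n: "\<forall>\<^sub>F N in sequentially. int (mu i + (N - 1 - i)) = int N + (int (mu i) - 1 - int i)"
    by (rule eventually_sequentiallyI[of "Suc i"]) auto
  show "(\<lambda>N. fps_nth (efps (node q \<sigma> \<tau> N) (mu i + (N - 1 - i))) k) \<longlonglongrightarrow>
      newton (node_power_sum q (int (mu i) - 1 - int i) \<sigma> \<tau>) k"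
    unfolding efps_nth_newton by (rule tendsto_newton, rule tendsto_node_power_sum[OF n]) simp
qed

lemma interp_limit_Sym_le: "is_partition mu \<Longrightarrow> interp_limit mu \<sigma> \<tau> \<in> Sym_le (psize mu)"
  unfolding interp_limit_def by (rule jacobi_trudi_Sym_le)

text \<open>The j-th limit power sum is homogeneous of degree j in \<sigma> and \<tau>, so
  \<open>newton_scale\<close> gives the weights that \<open>jacobi_trudi_scale\<close> asks
  for.\<close>

lemma interp_limit_scale:
  assumes mu: "is_partition mu" and r: "r \<noteq> 0"
  shows "r ^ psize mu * interp_limit mu \<sigma> \<tau> m = r ^ expo_deg m * interp_limit mu (r * \<sigma>) (r * \<tau>) m"
  unfolding interp_limit_def
  by (rule jacobi_trudi_scale[OF mu r], rule newton_scale)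
    (simp add: node_power_sum_def power_mult_distrib algebra_simps)

lemma tendsto_interp_limit:
  assumes "(f \<longlongrightarrow> \<sigma>) net"
  shows "((\<lambda>t. interp_limit mu (f t) \<tau> m) \<longlongrightarrow> interp_limit mu \<sigma> \<tau> m) net"
  unfolding interp_limit_def node_power_sum_def
proof (intro tendsto_jacobi_trudi tendsto_newton tendsto_intros assms)
  show "complex_of_real (1 - q ^ Suc j) \<noteq> 0" for j
    using power_Suc_less_one[OF q, of j] by (simp only: of_real_eq_0_iff)
qed

lemma I_A_eq:
  assumes "is_partition mu"
  shows "I_A mu (of_real q) = interp_limit mu 0 1"
proof -
  have "node q 0 1 = (\<lambda>N i. of_real q powi (int N - 1 - int i))"
    by (auto simp: node_def fun_eq_iff)
  then show ?thesis
    unfolding I_A_def interp_limit_eq[OF assms, symmetric] by simp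
qed

lemma I_BC_eq:
  assumes "is_partition mu"
  shows "I_BC mu (of_real q) s = interp_limit mu s (inverse s)"
proof -
  have "node q s (inverse s) = (\<lambda>N i. s * of_real q ^ i + inverse s * of_real q powi (int N - int i - 1))"
    by (auto simp: node_def fun_eq_iff diff_diff_add add.commute diff_diff_eq)
  then show ?thesis
    unfolding I_BC_def interp_limit_eq[OF assms, symmetric] by simp
qed

end

section \<open>The limit from q-Racah to big q-Jacobi functions\<close>

lemma tendsto_det:
  fixes A :: "'t \<Rightarrow> nat \<Rightarrow> nat \<Rightarrow> complex"
  assumes "\<And>i k. ((\<lambda>t. A t i k) \<longlongrightarrow> B i k) net"
  shows "((\<lambda>t. Determinant.det (mat n n (\<lambda>(i, k). A t i k))) \<longlongrightarrow>
    Determinant.det (mat n n (\<lambda>(i, k). B i k))) net"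
proof -
  have "Determinant.det (mat n n (\<lambda>(i, k). M i k)) =
      (\<Sum>p | p permutes {0..<n}. of_int (sign p) * (\<Prod>i = 0..<n. M i (p i)))"
    for M :: "nat \<Rightarrow> nat \<Rightarrow> complex"
    unfolding det_def'[OF mat_carrier]
    by (rule sum.cong) (auto dest: permutes_lessD intro!: prod.cong)
  then show ?thesis
    by (auto intro!: tendsto_intros assms)
qed

lemma tendsto_qpoch:
  assumes "(f \<longlongrightarrow> 0) net"
  shows "((\<lambda>t. qpoch (f t) q n) \<longlongrightarrow> 1) net"
proof -
  have "((\<lambda>t. \<Prod>k<n. 1 - f t * q ^ k) \<longlongrightarrow> (\<Prod>k<n. 1 - 0 * q ^ k)) net"
    by (intro tendsto_intros assms)
  then show ?thesis
    by (simp add: qpoch_def)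
qed

text \<open>With these parameters every factor of the entry except \<open>(-s\<^sub>0s\<^sub>1q\<^sup>m\<^sup>+\<^sup>1; q)\<^sub>n\<close> is
  independent of \<open>e\<close>.\<close>

lemma qR_entry_substitution:
  fixes q a b c d e :: complex
  assumes "q \<noteq> 0" "a \<noteq> 0" "b \<noteq> 0" "e \<noteq> 0"
  shows "qR_entry q (e * c) (e * d) (- q / (e * a)) (- q / (e * b)) l m =
    qpoch (e ^ 2 * (- c * d * q powi (m + 1))) q (nat (l - m)) * bqJ_entry q a b c d l m"
proof -
  have powi: "q powi (m + 2) = q * q powi (m + 1)" "q powi (l + m + 3) = q * (q * q powi (l + m + 1))"
    using assms by (simp_all add: power_int_add power2_eq_square power3_eq_cube)
  have s1: "- (e * c) * (e * d) * q powi (m + 1) = e ^ 2 * (- c * d * q powi (m + 1))"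
    by (simp add: power2_eq_square)
  have s23: "- (e * c) * (- q / (e * a)) * q powi (m + 1) = c / a * q powi (m + 2)"
    "- (e * c) * (- q / (e * b)) * q powi (m + 1) = c / b * q powi (m + 2)"
    unfolding powi using assms by simp_all
  have s0123: "(e * c) * (e * d) * (- q / (e * a)) * (- q / (e * b)) * q powi (l + m + 1) =
      c * d / (a * b) * q powi (l + m + 3)"
    unfolding powi using assms by simp
  show ?thesis
    unfolding qR_entry_def bqJ_entry_def Let_def s1 s23 s0123
    by (cases "l - m < 0") (simp_all only: if_True if_False mult_zero_right times_divide_eq_right mult.assoc)
qed

lemma psize_mono:
  assumes "is_partition lam" "is_partition mu" "\<And>i. mu i \<le> lam i"
  shows "psize mu \<le> psize lam"
proof -
  have fin: "finite {i. lam i \<noteq> 0}"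
    using assms(1) by (simp add: is_partition_def)
  have "lam i \<noteq> 0" if "mu i \<noteq> 0" for i
    using that assms(3)[of i] by simp
  then have sub: "{i. mu i \<noteq> 0} \<subseteq> {i. lam i \<noteq> 0}"
    by blast
  have "psize mu \<le> (\<Sum>i | mu i \<noteq> 0. lam i)"
    unfolding psize_def by (rule sum_mono) (rule assms)
  also have "\<dots> \<le> psize lam"
    unfolding psize_def by (rule sum_mono2[OF fin sub]) simp
  finally show ?thesis .
qed

lemma Phi_Sym_le:
  assumes "is_partition lam" "\<And>mu. is_partition mu \<Longrightarrow> F mu \<in> Sym_le (psize mu)"
  shows "(\<lambda>x. \<Sum>mu\<in>subpartitions lam. z mu * F mu x) \<in> Sym_le (psize lam)"
  by (intro Sym_le_sum Sym_le_cmult Sym_le_mono[OF assms(2)] psize_mono[OF assms(1)])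
    (auto simp: subpartitions_def)

text \<open>The prefactors leave \<open>e ^ psize mu\<close>. Homogeneity with factor e moves it and
  the rescaling of the variables into the nodes: \<open>e * c\<close> becomes
  \<open>e\<^sup>2 * c\<close>, and \<open>inverse (e * c)\<close> becomes
  \<open>inverse c\<close>.\<close>

lemma scaled_qR_term:
  fixes c e :: complex
  assumes q: "0 < q" "q < 1" and mu: "is_partition mu" and nz: "c \<noteq> 0" "e \<noteq> 0"
  shows "e ^ w * (inverse e ^ expo_deg x * ((e * c) powi (int (psize mu) - int w) * D * interp_limit q mu (e * c) (inverse (e * c)) x)) =
    c powi (int (psize mu) - int w) * D * interp_limit q mu (e\<^sup>2 * c) (inverse c) x"
proof -
  let ?I = "interp_limit q mu (e * c) (inverse (e * c)) x"
  have r: "e * (e * c) = e\<^sup>2 * c" "e * inverse (e * c) = inverse c"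
    using nz by (simp_all add: power2_eq_square)
  have "e ^ psize mu * ?I = e ^ expo_deg x * interp_limit q mu (e\<^sup>2 * c) (inverse c) x"
    unfolding interp_limit_scale[OF q mu nz(2)] r ..
  then have I: "interp_limit q mu (e\<^sup>2 * c) (inverse c) x = inverse e ^ expo_deg x * (e ^ psize mu * ?I)"
    using nz by (simp add: field_simps)
  have "e ^ w * (e * c) powi (int (psize mu) - int w) = c powi (int (psize mu) - int w) * e ^ psize mu"
    using nz by (simp add: power_int_mult_distrib power_int_diff)
  then show ?thesis
    unfolding I by (simp add: mult_ac)
qed

text \<open>Homogeneity with factor c turns the node parameter \<open>inverse c\<close> into 1 and X
  into cX, which gives the terms of \<open>Phi_bqJ\<close>.\<close>

lemma interp_limit_rescale:
  assumes q: "0 < q" "q < 1" and mu: "is_partition mu" and c: "c \<noteq> 0"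
  shows "c powi (int (psize mu) - int w) * D * interp_limit q mu 0 (inverse c) x =
    c powi (- int w) * D * sym_scale c (interp_limit q mu 0 1) x"
proof -
  have "c ^ psize mu * interp_limit q mu 0 (inverse c) x = c ^ expo_deg x * interp_limit q mu 0 1 x"
    using interp_limit_scale[OF q mu c, of 0 "inverse c" x] c by simp
  moreover have "c powi (int (psize mu) - int w) = c powi (- int w) * c ^ psize mu"
    using c by (simp add: power_int_diff power_int_minus field_simps)
  ultimately show ?thesis
    by (simp add: sym_scale_def mult_ac)
qed

text \<open>For c: zero is real, and each of the two kinds of interval lies on one side of
  it.\<close>

lemma admissible_nonzero:
  assumes "0 < q" "admissible q a b c d"
  shows "a \<noteq> 0" "b \<noteq> 0" "c \<noteq> 0"
proof -
  show "a \<noteq> 0" "b \<noteq> 0"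
    using assms(2) by (auto simp: admissible_def)
  show "c \<noteq> 0"
  proof
    assume "c = 0"
    then obtain m :: int where m: "(a * q powi m < 0 \<and> a > 0) \<or> (b * q powi m > 0 \<and> b < 0)"
      using assms(2) by (auto simp: admissible_def)
    then show False
      using zero_less_power_int[OF assms(1), of m] by (auto simp: mult_less_0_iff zero_less_mult_iff)
  qed
qed

theorem theorem4p8:
  fixes q a b :: real and c d :: complex and lam :: "nat \<Rightarrow> nat"
  assumes "0 < q" and "q < 1"
    and "admissible q a b c d"
    and "is_partition lam"
  shows "limitin (Sym_le_top (psize lam))
    (\<lambda>\<epsilon>::real. (\<lambda>x. complex_of_real \<epsilon> ^ psize lam *
       sym_scale (inverse (complex_of_real \<epsilon>))
         (Phi_qR lam (complex_of_real q)
            (complex_of_real \<epsilon> * c) (complex_of_real \<epsilon> * d)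
            (- complex_of_real q / (complex_of_real \<epsilon> * complex_of_real a))
            (- complex_of_real q / (complex_of_real \<epsilon> * complex_of_real b))) x))
    (Phi_bqJ lam (complex_of_real q) (complex_of_real a) (complex_of_real b) c d)
    (at 0 within {q ^ k / sqrt (- a * b) | k::nat. k \<ge> 1})"
    (is "limitin _ ?F _ (at 0 within ?S)")
proof -
  note q = assms(1,2) and lam = assms(4)
  have nz: "complex_of_real q \<noteq> 0" "complex_of_real a \<noteq> 0" "complex_of_real b \<noteq> 0" "c \<noteq> 0"
    using q admissible_nonzero[OF assms(1,3)] by auto
  define D where "D mu = Determinant.det (Matrix.mat (plength lam) (plength lam) (\<lambda>(j, k).
      bqJ_entry q a b c d (int (lam j) - int (j + 1)) (int (mu k) - int (k + 1))))" for mu :: "nat \<Rightarrow> nat"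
  \<comment> \<open>The q-Racah determinant after \<open>qR_entry_substitution\<close>: each entry
    of D gains a q-Pochhammer symbol whose argument is a multiple of \<open>e ^ 2\<close>, so that
    the symbol tends to 1.\<close>
  define D' where "D' e mu = Determinant.det (Matrix.mat (plength lam) (plength lam) (\<lambda>(j, k).
      qpoch (complex_of_real e ^ 2 * (- c * d * of_real q powi ((int (mu k) - int (k + 1)) + 1))) q
        (nat ((int (lam j) - int (j + 1)) - (int (mu k) - int (k + 1)))) *
      bqJ_entry q a b c d (int (lam j) - int (j + 1)) (int (mu k) - int (k + 1))))"
    for e and mu :: "nat \<Rightarrow> nat"
  have D': "((\<lambda>e. D' e mu) \<longlongrightarrow> D mu) (at 0 within ?S)" for mu
    unfolding D_def D'_def
  proof (rule tendsto_det)
    fix j k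
    have "((\<lambda>e. complex_of_real e ^ 2 * z) \<longlongrightarrow> of_real 0 ^ 2 * z) (at 0 within ?S)" for z
      by (intro tendsto_intros)
    then have "((\<lambda>e. complex_of_real e ^ 2 * z) \<longlongrightarrow> 0) (at 0 within ?S)" for z
      by simp
    from tendsto_mult[OF tendsto_qpoch[OF this] tendsto_const]
    have "((\<lambda>e. qpoch (complex_of_real e ^ 2 * z) q n * y) \<longlongrightarrow> 1 * y) (at 0 within ?S)" for z y n .
    then show "((\<lambda>e. qpoch (complex_of_real e ^ 2 * (- c * d * of_real q powi ((int (mu k) - int (k + 1)) + 1))) q
        (nat ((int (lam j) - int (j + 1)) - (int (mu k) - int (k + 1)))) *
      bqJ_entry q a b c d (int (lam j) - int (j + 1)) (int (mu k) - int (k + 1))) \<longlongrightarrow>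
      bqJ_entry q a b c d (int (lam j) - int (j + 1)) (int (mu k) - int (k + 1))) (at 0 within ?S)"
      unfolding mult_1 .
  qed
  \<comment> \<open>For nonzero e, prefactor, rescaling and parameters combine into an expression
    that extends continuously to \<open>e = 0\<close>.\<close>
  have F: "?F e x = (\<Sum>mu\<in>subpartitions lam.
      c powi (int (psize mu) - int (psize lam)) * D' e mu * interp_limit q mu ((of_real e)\<^sup>2 * c) (inverse c) x)"
    if "e \<noteq> 0" for e x
    unfolding sym_scale_def Phi_qR_def sum_distrib_left
  proof (rule sum.cong)
    fix mu assume "mu \<in> subpartitions lam"
    then have mu: "is_partition mu"
      by (simp add: subpartitions_def)
    have e: "complex_of_real e \<noteq> 0"
      using that by simp
    show "of_real e ^ psize lam * (inverse (of_real e) ^ expo_deg x *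
        (sigma_qR lam mu q (of_real e * c) (of_real e * d) (- of_real q / (of_real e * of_real a))
          (- of_real q / (of_real e * of_real b)) * I_BC mu (of_real q) (of_real e * c) x)) =
      c powi (int (psize mu) - int (psize lam)) * D' e mu * interp_limit q mu ((of_real e)\<^sup>2 * c) (inverse c) x"
      unfolding sigma_qR_def qR_entry_substitution[OF nz(1-3) e] D'_def[symmetric] I_BC_eq[OF q mu]
      by (rule scaled_qR_term[OF q mu nz(4) e])
  qed simp
  have F_Sym: "?F e \<in> Sym_le (psize lam)" for e
    unfolding Phi_qR_def
    by (intro Sym_le_cmult sym_scale_Sym_le Phi_Sym_le[OF lam])
      (simp add: I_BC_eq[OF q] interp_limit_Sym_le[OF q])
  \<comment> \<open>The value of the same expression at \<open>e = 0\<close>, where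
    \<open>D' e\<close> becomes D and the nodes have parameters 0 and
    \<open>inverse c\<close>.\<close>
  have limit: "Phi_bqJ lam q a b c d x = (\<Sum>mu\<in>subpartitions lam.
      c powi (int (psize mu) - int (psize lam)) * D mu * interp_limit q mu 0 (inverse c) x)" for x
    unfolding Phi_bqJ_def sigma_bqJ_def D_def[symmetric]
    by (rule sum.cong)
      (auto simp: subpartitions_def I_A_eq[OF q] interp_limit_rescale[OF q _ nz(4)])
  have "((\<lambda>e. ?F e x) \<longlongrightarrow> Phi_bqJ lam q a b c d x) (at 0 within ?S)" for x
  proof (rule Lim_transform_eventually)
    have "((\<lambda>e. (complex_of_real e)\<^sup>2 * c) \<longlongrightarrow> (of_real 0)\<^sup>2 * c) (at 0 within ?S)"
      by (intro tendsto_intros)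
    then have "((\<lambda>e. (complex_of_real e)\<^sup>2 * c) \<longlongrightarrow> 0) (at 0 within ?S)"
      by simp
    then show "((\<lambda>e. \<Sum>mu\<in>subpartitions lam.
      c powi (int (psize mu) - int (psize lam)) * D' e mu * interp_limit q mu ((of_real e)\<^sup>2 * c) (inverse c) x)
      \<longlongrightarrow> Phi_bqJ lam q a b c d x) (at 0 within ?S)"
      unfolding limit by (intro tendsto_intros D' tendsto_interp_limit[OF q])
    show "\<forall>\<^sub>F e in at 0 within ?S. (\<Sum>mu\<in>subpartitions lam.
      c powi (int (psize mu) - int (psize lam)) * D' e mu * interp_limit q mu ((of_real e)\<^sup>2 * c) (inverse c) x) = ?F e x"
      \<comment> \<open>The filter omits \<open>e = 0\<close>, so F applies at every remaining
        point.\<close>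
      unfolding eventually_at_filter by (intro always_eventually allI impI) (rule F[symmetric])
  qed
  moreover have "Phi_bqJ lam q a b c d \<in> Sym_le (psize lam)"
    unfolding Phi_bqJ_def
    by (intro Phi_Sym_le[OF lam] sym_scale_Sym_le) (simp add: I_A_eq[OF q] interp_limit_Sym_le[OF q])
  ultimately show ?thesis
    unfolding limitin_Sym_le_top_iff using F_Sym by simp
qed

end
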